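(* Let $\mathcal{P}$ be a reliable graph property with $d(\mathcal{P})=r$, let $G$ be a graph, and let $(X,H)$ be a $\mathcal{P}$-critical cover of $G$. Let $V(G,X,H,\mathcal{P})=\{v\in V(G) : d_G(v)=r|X_v|\}$. If $B$ is a block of the low vertex subgraph $G[V(G,X,H,\mathcal{P})]$ of $G$, then $B$ is a brick, or $B=tB'$ with $t\in\mathbb{N}$ such that either $B'\in \mathrm{CR}(\mathcal{P})$ and $B'$ is $r$-regular, or $B'\in\mathcal{P}$ and $\Delta(B')\le r$.
   Context: $\mathbb{N}$ is the set of positive integers. Graphs are finite, undirected, may have multiple edges, no loops. $\mu_G(u,v)$ is the number of edges joining $u$ and $v$; $d_G(v)$ is the number of edges incident with $v$; $\Delta,\delta$ denote maximum and minimum degree. $G$ is simple if all multiplicities are at most $1$. $K_n$ (complete graph) and $C_n$ ($n\ge 3$, cycle) are simple graphs. For $t\in\mathbb{N}$, $tG$ is the graph with vertex set $V(G)$ and $\mu_{tG}(u,v)=t\mu_G(u,v)$. A brick is a graph of the form $tK_n$ with $t,n\in\mathbb{N}$ or $tC_n$ with $t,n\in\mathbb{N}$, $n\ge 3$. A separating vertex of a connected graph is a vertex whose deletion leaves at least two components (for disconnected graphs: a separating vertex of a component); a block of $G$ is a maximal connected subgraph that itself has no separating vertex ($K_1$ is allowed). A cover of $G$ is a pair $(X,H)$ where $H$ is a graph and $X$ assigns to each $v\in V(G)$ a set $X_v\subseteq V(H)$ such that the sets $X_v$ are pairwise disjoint, $V(H)=\bigcup_v X_v$, each $X_v$ is independent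 in $H$, and for distinct $u,v\in V(G)$ the set $E_H(X_u,X_v)$ of edges of $H$ between $X_u$ and $X_v$ is the union of $\mu_G(u,v)$ (possibly empty) matchings of $H$. A transversal of $(X,H)$ is a set $T\subseteq V(H)$ with $|T\cap X_v|=1$ for all $v\in V(G)$; a partial transversal satisfies $|T\cap X_v|\le 1$ for all $v$; $\mathrm{dom}(T:G)=\{v\in V(G): X_v\cap T\neq\varnothing\}$. A graph property is a class of graphs closed under isomorphism. It is non-trivial if it contains a non-empty graph but not all graphs; hereditary if closed under induced subgraphs; additive if closed under disjoint unions; reliable if non-trivial, hereditary and additive. For non-trivial hereditary $\mathcal{P}$: $\mathrm{CR}(\mathcal{P})$ is the class of graphs $G\notin\mathcal{P}$ with $G-v\in\mathcal{P}$ for all $v\in V(G)$, and $d(\mathcal{P})=\min\{\delta(G): G\in\mathrm{CR}(\mathcal{P})\}$. A $\mathcal{P}$-transversal of $(X,H)$ is a transversal $T$ with $H[T]\in\mathcal{P}$. The cover $(X,H)$ of $G$ is $\mathcal{P}$-critical if it has no $\mathcal{P}$-transversal, but for every $v\in V(G)$ there is a partial transversal $T$ with $\mathrm{dom}(T:G)=V(G)\setminus\{v\}$ and $H[T]\in\mathcal{P}$. *)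

theory Defs
  imports Main "HOL-Library.Disjoint_Sets"
begin

text \<open>
  Finite loopless undirected multigraphs, given by their vertex set and multiplicity function.
  Multiplicities are normalised to 0 outside the vertex set, so that equality of graphs is
  equality of vertex sets and multiplicities.
\<close>

typedef 'a mgraph =
  "{(V :: 'a set, m :: 'a \<Rightarrow> 'a \<Rightarrow> nat).
      finite V \<and> (\<forall>u v. m u v = m v u) \<and> (\<forall>v. m v v = 0) \<and> (\<forall>u v. m u v \<noteq> 0 \<longrightarrow> u \<in> V)}"
  by (rule exI[of _ "({}, \<lambda>_ _. 0)"]) simp

setup_lifting type_definition_mgraph

lift_definition verts :: "'a mgraph \<Rightarrow> 'a set" is fst .

lift_definition mult :: "'a mgraph \<Rightarrow> 'a \<Rightarrow> 'a \<Rightarrow> nat" is snd .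

text \<open>The i-th edge joining u and v is the pair of the set of its ends and its index i.\<close>

definition edges :: "'a mgraph \<Rightarrow> ('a set \<times> nat) set" where
  "edges G = {({u, v}, i) | u v i. i < mult G u v}"

definition degree :: "'a mgraph \<Rightarrow> 'a \<Rightarrow> nat" where
  "degree G v = card {e \<in> edges G. v \<in> fst e}"

definition max_degree :: "'a mgraph \<Rightarrow> nat" where
  "max_degree G = Max (degree G ` verts G)"

definition min_degree :: "'a mgraph \<Rightarrow> nat" where
  "min_degree G = Min (degree G ` verts G)"

definition regular :: "nat \<Rightarrow> 'a mgraph \<Rightarrow> bool" where
  "regular r G \<longleftrightarrow> (\<forall>v \<in> verts G. degree G v = r)"

definition iso :: "'a mgraph \<Rightarrow> 'b mgraph \<Rightarrow> bool" where
  "iso G G' \<longleftrightarrow> (\<exists>f. bij_betw f (verts G) (verts G') \<and>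
     (\<forall>u \<in> verts G. \<forall>v \<in> verts G. mult G' (f u) (f v) = mult G u v))"

definition subgraph :: "'a mgraph \<Rightarrow> 'a mgraph \<Rightarrow> bool" where
  "subgraph G' G \<longleftrightarrow> verts G' \<subseteq> verts G \<and> (\<forall>u v. mult G' u v \<le> mult G u v)"

lift_definition induced :: "'a mgraph \<Rightarrow> 'a set \<Rightarrow> 'a mgraph" is
  "\<lambda>(V, m) S. (V \<inter> S, \<lambda>u v. if u \<in> S \<and> v \<in> S then m u v else 0)"
  by (fastforce split: if_splits prod.splits)

definition delete_vertex :: "'a mgraph \<Rightarrow> 'a \<Rightarrow> 'a mgraph" where
  "delete_vertex G v = induced G (verts G - {v})"

text \<open>Only used for graphs with disjoint vertex sets.\<close>

lift_definition graph_union :: "'a mgraph \<Rightarrow> 'a mgraph \<Rightarrow> 'a mgraph" is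
  "\<lambda>(V, m) (V', m'). (V \<union> V', \<lambda>u v. m u v + m' u v)"
  by (clarsimp split: prod.splits) blast

lift_definition scale :: "nat \<Rightarrow> 'a mgraph \<Rightarrow> 'a mgraph" is
  "\<lambda>t (V, m). (V, \<lambda>u v. t * m u v)"
  by (fastforce split: prod.splits)

lift_definition complete_graph :: "nat \<Rightarrow> nat mgraph" is
  "\<lambda>n. ({..<n}, \<lambda>u v. if u < n \<and> v < n \<and> u \<noteq> v then 1 else 0)"
  by auto

text \<open>The cycle of length n, for n at least 3.\<close>

lift_definition cycle_graph :: "nat \<Rightarrow> nat mgraph" is
  "\<lambda>n. ({..<n}, \<lambda>u v. if u < n \<and> v < n \<and> u \<noteq> v \<and> (v = Suc u mod n \<or> u = Suc v mod n) then 1 else 0)"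
  by auto

definition brick :: "'a mgraph \<Rightarrow> bool" where
  "brick B \<longleftrightarrow>
     (\<exists>t n. t \<ge> 1 \<and> n \<ge> 1 \<and> iso B (scale t (complete_graph n))) \<or>
     (\<exists>t n. t \<ge> 1 \<and> n \<ge> 3 \<and> iso B (scale t (cycle_graph n)))"

text \<open>The empty graph is not connected; in particular it has no components and no blocks.\<close>

definition connected_graph :: "'a mgraph \<Rightarrow> bool" where
  "connected_graph G \<longleftrightarrow> verts G \<noteq> {} \<and>
     (\<forall>u \<in> verts G. \<forall>v \<in> verts G. (\<lambda>x y. mult G x y > 0)\<^sup>*\<^sup>* u v)"

definition components :: "'a mgraph \<Rightarrow> 'a mgraph set" where
  "components G = {C. subgraph C G \<and> connected_graph C \<and>
     (\<forall>C'. subgraph C' G \<and> connected_graph C' \<and> subgraph C C' \<longrightarrow> C' = C)}"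

definition separating_vertex :: "'a mgraph \<Rightarrow> 'a \<Rightarrow> bool" where
  "separating_vertex G v \<longleftrightarrow>
     (\<exists>C \<in> components G. v \<in> verts C \<and> card (components (delete_vertex C v)) \<ge> 2)"

definition nonseparable :: "'a mgraph \<Rightarrow> bool" where
  "nonseparable G \<longleftrightarrow> connected_graph G \<and> \<not> (\<exists>v. separating_vertex G v)"

definition is_block :: "'a mgraph \<Rightarrow> 'a mgraph \<Rightarrow> bool" where
  "is_block B G \<longleftrightarrow> subgraph B G \<and> nonseparable B \<and>
     (\<forall>B'. subgraph B' G \<and> nonseparable B' \<and> subgraph B B' \<longrightarrow> B' = B)"

text \<open>
  Every finite graph has an isomorphic copy with vertices in the natural numbers, so an
  isomorphism-closed class of graphs is represented by its members of type \<^typ>\<open>nat mgraph\<close>;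
  the predicate \<open>has_prop\<close> is membership in the class for graphs over an arbitrary vertex type.
\<close>

definition graph_property :: "nat mgraph set \<Rightarrow> bool" where
  "graph_property P \<longleftrightarrow> (\<forall>G \<in> P. \<forall>G'. iso G G' \<longrightarrow> G' \<in> P)"

definition has_prop :: "nat mgraph set \<Rightarrow> 'a mgraph \<Rightarrow> bool" where
  "has_prop P G \<longleftrightarrow> (\<exists>G' \<in> P. iso G G')"

definition nontrivial :: "nat mgraph set \<Rightarrow> bool" where
  "nontrivial P \<longleftrightarrow> (\<exists>G \<in> P. verts G \<noteq> {}) \<and> P \<noteq> UNIV"

definition hereditary :: "nat mgraph set \<Rightarrow> bool" where
  "hereditary P \<longleftrightarrow> (\<forall>G \<in> P. \<forall>S \<subseteq> verts G. induced G S \<in> P)"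

definition additive :: "nat mgraph set \<Rightarrow> bool" where
  "additive P \<longleftrightarrow>
     (\<forall>G \<in> P. \<forall>G' \<in> P. verts G \<inter> verts G' = {} \<longrightarrow> graph_union G G' \<in> P)"

definition reliable :: "nat mgraph set \<Rightarrow> bool" where
  "reliable P \<longleftrightarrow> graph_property P \<and> nontrivial P \<and> hereditary P \<and> additive P"

definition CR :: "nat mgraph set \<Rightarrow> nat mgraph set" where
  "CR P = {G. G \<notin> P \<and> (\<forall>v \<in> verts G. delete_vertex G v \<in> P)}"

text \<open>For non-trivial hereditary P, \<open>CR P\<close> is non-empty and contains only non-empty graphs.\<close>

definition prop_d :: "nat mgraph set \<Rightarrow> nat" where
  "prop_d P = (LEAST k. \<exists>G \<in> CR P. k = min_degree G)"

definition independent :: "'a mgraph \<Rightarrow> 'a set \<Rightarrow> bool" where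
  "independent G S \<longleftrightarrow> (\<forall>x \<in> S. \<forall>y \<in> S. mult G x y = 0)"

definition edges_between :: "'a mgraph \<Rightarrow> 'a set \<Rightarrow> 'a set \<Rightarrow> ('a set \<times> nat) set" where
  "edges_between G A B = {e \<in> edges G. \<exists>x \<in> A. \<exists>y \<in> B. fst e = {x, y}}"

definition matching :: "'a mgraph \<Rightarrow> ('a set \<times> nat) set \<Rightarrow> bool" where
  "matching G M \<longleftrightarrow> M \<subseteq> edges G \<and> (\<forall>e \<in> M. \<forall>e' \<in> M. e \<noteq> e' \<longrightarrow> fst e \<inter> fst e' = {})"

definition is_cover :: "'a mgraph \<Rightarrow> ('a \<Rightarrow> 'b set) \<Rightarrow> 'b mgraph \<Rightarrow> bool" where
  "is_cover G X H \<longleftrightarrow>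
     disjoint_family_on X (verts G) \<and>
     verts H = (\<Union>v \<in> verts G. X v) \<and>
     (\<forall>v \<in> verts G. independent H (X v)) \<and>
     (\<forall>u \<in> verts G. \<forall>v \<in> verts G. u \<noteq> v \<longrightarrow>
        (\<exists>M :: nat \<Rightarrow> ('b set \<times> nat) set.
           (\<forall>i < mult G u v. matching H (M i)) \<and>
           edges_between H (X u) (X v) = (\<Union>i < mult G u v. M i)))"

definition transversal :: "'a mgraph \<Rightarrow> ('a \<Rightarrow> 'b set) \<Rightarrow> 'b mgraph \<Rightarrow> 'b set \<Rightarrow> bool" where
  "transversal G X H T \<longleftrightarrow> T \<subseteq> verts H \<and> (\<forall>v \<in> verts G. card (T \<inter> X v) = 1)"

definition partial_transversal :: "'a mgraph \<Rightarrow> ('a \<Rightarrow> 'b set) \<Rightarrow> 'b mgraph \<Rightarrow> 'b set \<Rightarrow> bool" where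
  "partial_transversal G X H T \<longleftrightarrow> T \<subseteq> verts H \<and> (\<forall>v \<in> verts G. card (T \<inter> X v) \<le> 1)"

definition transversal_dom :: "'a mgraph \<Rightarrow> ('a \<Rightarrow> 'b set) \<Rightarrow> 'b set \<Rightarrow> 'a set" where
  "transversal_dom G X T = {v \<in> verts G. X v \<inter> T \<noteq> {}}"

definition critical_cover ::
  "nat mgraph set \<Rightarrow> 'a mgraph \<Rightarrow> ('a \<Rightarrow> 'b set) \<Rightarrow> 'b mgraph \<Rightarrow> bool" where
  "critical_cover P G X H \<longleftrightarrow>
     is_cover G X H \<and>
     \<not> (\<exists>T. transversal G X H T \<and> has_prop P (induced H T)) \<and>
     (\<forall>v \<in> verts G. \<exists>T. partial_transversal G X H T \<and>
        transversal_dom G X T = verts G - {v} \<and> has_prop P (induced H T))"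

definition low_vertices :: "nat mgraph set \<Rightarrow> 'a mgraph \<Rightarrow> ('a \<Rightarrow> 'b set) \<Rightarrow> 'a set" where
  "low_vertices P G X = {v \<in> verts G. degree G v = prop_d P * card (X v)}"

end

theory Submission imports Defs begin

text \<open>
  Consider the partial transversals with property \<open>P\<close> that miss exactly one vertex \<open>v\<close>, the hole.
  If \<open>v\<close> is low, double counting the edges between \<open>X v\<close> and such a transversal is tight: every
  colour of \<open>v\<close> has exactly \<open>r\<close> neighbours in the transversal, and the token at \<open>u\<close> has exactly
  \<open>\<mu>(v,u)\<close> neighbours in \<open>X v\<close>. Hence the hole can move from \<open>v\<close> to \<open>u\<close> by giving \<open>v\<close> any colour
  adjacent to the token at \<open>u\<close>, as in a sliding puzzle on the block.

  Let \<open>A u\<close> be the set of colours of \<open>v\<close> adjacent to the token at \<open>u\<close>. Sending the hole once around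
  a cycle that meets the neighbourhood of \<open>v\<close> only in \<open>u\<close> and \<open>w\<close> interchanges \<open>A u\<close> and \<open>A w\<close>,
  which are equal, or disjoint with \<open>\<mu>(v,u) = \<mu>(v,w)\<close>.
  If all these sets always coincide, the tokens together with one colour from the common set induce
  a copy of \<open>B'\<close>, where \<open>B = t B'\<close> and \<open>t\<close> is the size of the common set.
  Otherwise different sets can be put on the two ends of any such cycle at any vertex, so all
  multiplicities are equal; moreover \<open>A w\<close> is determined by the token two steps behind \<open>v\<close> on the
  other side of the cycle, which forces every vertex that is not universal to have degree two, so
  that the block is complete or a cycle.
\<close>

section \<open>Paths and reachability\<close>

text \<open>The closure is reflexive, so \<open>reach E S x x\<close> holds even for
  \<open>x\<close> outside \<open>S\<close>; turning reachability into a path inside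
  \<open>S\<close> therefore asks for \<open>x\<close> in \<open>S\<close>.\<close>

definition reach :: "('a \<Rightarrow> 'a \<Rightarrow> bool) \<Rightarrow> 'a set \<Rightarrow> 'a \<Rightarrow> 'a \<Rightarrow> bool" where
  "reach E S = (\<lambda>x y. E x y \<and> x \<in> S \<and> y \<in> S)\<^sup>*\<^sup>*"

definition is_path :: "('a \<Rightarrow> 'a \<Rightarrow> bool) \<Rightarrow> 'a set \<Rightarrow> 'a list \<Rightarrow> bool" where
  "is_path E S p \<longleftrightarrow> p \<noteq> [] \<and> successively E p \<and> distinct p \<and> set p \<subseteq> S"

lemma reach_refl: "reach E S x x"
  by (simp add: reach_def)

lemma reach_trans: "reach E S x y \<Longrightarrow> reach E S y z \<Longrightarrow> reach E S x z"
  by (simp add: reach_def)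

lemma reach_edge: "E x y \<Longrightarrow> x \<in> S \<Longrightarrow> y \<in> S \<Longrightarrow> reach E S x y"
  by (simp add: reach_def r_into_rtranclp)

lemma reach_sym:
  assumes "symp E" "reach E S x y"
  shows "reach E S y x"
proof -
  have "symp (\<lambda>x y. E x y \<and> x \<in> S \<and> y \<in> S)"
    using assms(1) by (auto simp: symp_def)
  from sympD[OF symp_rtranclp[OF this]] assms(2) show ?thesis
    unfolding reach_def by blast
qed

lemma reach_mono:
  assumes "reach E S x y" "S \<subseteq> S'"
  shows "reach E S' x y"
proof -
  have "(\<lambda>x y. E x y \<and> x \<in> S \<and> y \<in> S) \<le> (\<lambda>x y. E x y \<and> x \<in> S' \<and> y \<in> S')"
    using assms(2) by auto
  from rtranclp_mono[OF this] assms(1) show ?thesis unfolding reach_def by blast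
qed

lemma is_path_appendD:
  assumes "is_path E S (p @ q)"
  shows "p \<noteq> [] \<Longrightarrow> is_path E S p" "q \<noteq> [] \<Longrightarrow> is_path E S q"
  using assms by (auto simp: is_path_def successively_append_iff)

lemma reach_imp_path:
  assumes "reach E S x y" "x \<in> S"
  shows "\<exists>p. is_path E S p \<and> hd p = x \<and> last p = y"
  using assms(1) unfolding reach_def
proof (induction rule: rtranclp_induct)
  case base
  show ?case using assms(2) by (intro exI[of _ "[x]"]) (simp add: is_path_def)
next
  case (step y z)
  then obtain p where p: "is_path E S p" "hd p = x" "last p = y" by blast
  show ?case
  proof (cases "z \<in> set p")
    case True
    \<comment> \<open>The walk has returned to a vertex already on \<open>p\<close>; the path is cut
      there.\<close>
    then obtain q q' where "p = (q @ [z]) @ q'" by (metis append.assoc append_Cons append_Nil split_list)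
    thus ?thesis using p is_path_appendD(1)[of E S "q @ [z]" q']
      by (intro exI[of _ "q @ [z]"]) (auto simp: hd_append)
  next
    case False
    thus ?thesis using p step(2)
      by (intro exI[of _ "p @ [z]"]) (auto simp: is_path_def successively_append_iff)
  qed
qed

lemma path_imp_reach:
  assumes "is_path E S p"
  shows "reach E S (hd p) (last p)"
  using assms
proof (induction p rule: induct_list012)
  case (3 x y zs)
  then show ?case
    by (auto simp: is_path_def intro: reach_trans[OF reach_edge])
qed (auto simp: is_path_def reach_refl)

lemma is_path_rev: "symp E \<Longrightarrow> is_path E S p \<Longrightarrow> is_path E S (rev p)"
  by (auto simp: is_path_def elim!: successively_mono dest: sympD)

section \<open>Sliding tokens\<close>

text \<open>
  \<open>good v \<tau>\<close> says that \<open>\<tau>\<close> is an admissible placement of tokens with hole \<open>v\<close>; the value of \<open>\<tau>\<close> at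
  \<open>v\<close> itself is irrelevant. The vertices in \<open>W\<close> are those to which the hole may move.
\<close>

locale token_system =
  fixes V W :: "'a set" and X :: "'a \<Rightarrow> 'b set" and a :: "'b \<Rightarrow> 'b \<Rightarrow> nat"
    and \<mu> :: "'a \<Rightarrow> 'a \<Rightarrow> nat" and r :: nat and good :: "'a \<Rightarrow> ('a \<Rightarrow> 'b) \<Rightarrow> bool"
  assumes finite_V: "finite V" and W_subset: "W \<subseteq> V"
    and finite_X: "v \<in> W \<Longrightarrow> finite (X v)"
    and a_sym: "a x y = a y x"
    and \<mu>_sym: "\<mu> u v = \<mu> v u" and \<mu>_irrefl: "\<mu> v v = 0"
    and good_in: "good v \<tau> \<Longrightarrow> u \<in> V \<Longrightarrow> u \<noteq> v \<Longrightarrow> \<tau> u \<in> X u"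
    and col: "good v \<tau> \<Longrightarrow> v \<in> W \<Longrightarrow> u \<in> V \<Longrightarrow> u \<noteq> v \<Longrightarrow> (\<Sum>x\<in>X v. a x (\<tau> u)) = \<mu> v u"
    and row: "good v \<tau> \<Longrightarrow> v \<in> W \<Longrightarrow> x \<in> X v \<Longrightarrow> (\<Sum>u\<in>V - {v}. a x (\<tau> u)) = r"
    and move: "good v \<tau> \<Longrightarrow> v \<in> W \<Longrightarrow> u \<in> W \<Longrightarrow> u \<noteq> v \<Longrightarrow> x \<in> X v \<Longrightarrow> a x (\<tau> u) > 0
       \<Longrightarrow> good u (\<tau>(v := x))"
begin

definition E :: "'a \<Rightarrow> 'a \<Rightarrow> bool" where
  "E u v \<longleftrightarrow> u \<in> W \<and> v \<in> W \<and> \<mu> u v > 0"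

definition A :: "'a \<Rightarrow> ('a \<Rightarrow> 'b) \<Rightarrow> 'a \<Rightarrow> 'b set" where
  "A v \<tau> u = {x \<in> X v. a x (\<tau> u) > 0}"

text \<open>Closing \<open>p\<close> through \<open>v\<close> gives a cycle on which
  \<open>v\<close> has no chord. Length 2 is a triangle, and the length bound keeps the two ends
  distinct.\<close>

definition ear :: "'a \<Rightarrow> 'a list \<Rightarrow> bool" where
  "ear v p \<longleftrightarrow> v \<in> W \<and> is_path E (W - {v}) p \<and> length p \<ge> 2 \<and>
     (\<forall>x\<in>set p. E v x \<longleftrightarrow> x = hd p \<or> x = last p)"

lemma E_sym: "E u v \<Longrightarrow> E v u"
  using \<mu>_sym by (simp add: E_def)

lemma symp_E: "symp E"
  by (simp add: E_sym symp_def)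

lemma E_irrefl: "\<not> E v v"
  by (simp add: E_def \<mu>_irrefl)

section \<open>Consequences of the tight counts at a hole\<close>

text \<open>Filling \<open>v\<close> with any \<open>z\<close> from \<open>A v \<tau> u\<close>
  moves the hole to \<open>u\<close>. The row of \<open>y\<close> there sums to \<open>r\<close>,
  and only its term for \<open>v\<close> depends on \<open>z\<close>.\<close>

lemma nbr_const:
  assumes g: "good v \<tau>" and "v \<in> W" "u \<in> W" "u \<noteq> v"
    and x: "x \<in> A v \<tau> u" "x' \<in> A v \<tau> u" and y: "y \<in> X u"
  shows "a y x = a y x'"
proof -
  have *: "a y z + (\<Sum>w\<in>V - {u} - {v}. a y (\<tau> w)) = r" if "z \<in> A v \<tau> u" for z
  proof -
    have "good u (\<tau>(v := z))"
      using that assms(2-4) by (intro move[OF g]) (auto simp: A_def)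
    from row[OF this \<open>u \<in> W\<close> y]
    have "r = (\<Sum>w\<in>V - {u}. a y ((\<tau>(v := z)) w))" by simp
    also have "\<dots> = a y z + (\<Sum>w\<in>V - {u} - {v}. a y ((\<tau>(v := z)) w))"
      using finite_V W_subset assms(2-4) by (subst sum.remove[of _ v]) auto
    also have "(\<Sum>w\<in>V - {u} - {v}. a y ((\<tau>(v := z)) w)) = (\<Sum>w\<in>V - {u} - {v}. a y (\<tau> w))"
      by (intro sum.cong) auto
    finally show ?thesis by simp
  qed
  show ?thesis using *[OF x(1)] *[OF x(2)] by linarith
qed

lemma mult_const:
  assumes g: "good v \<tau>" and "v \<in> W" "u \<in> W" "u \<noteq> v"
    and x: "x \<in> A v \<tau> u" "x' \<in> A v \<tau> u"
  shows "a x (\<tau> u) = a x' (\<tau> u)"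
proof -
  have "\<tau> u \<in> X u" using good_in[OF g] assms W_subset by blast
  from nbr_const[OF assms this] show ?thesis by (simp add: a_sym)
qed

text \<open>Seen from \<open>u\<close>, after the hole has moved there with \<open>v\<close>
  coloured \<open>x\<close>, both \<open>y\<close> and the old token are colours of \<open>u\<close>
  adjacent to \<open>x\<close>; \<open>mult_const\<close> applies with the roles exchanged.\<close>

lemma mult_const':
  assumes g: "good v \<tau>" and "v \<in> W" "u \<in> W" "u \<noteq> v"
    and x: "x \<in> A v \<tau> u" and y: "y \<in> X u" "a x y > 0"
  shows "a x y = a x (\<tau> u)"
proof -
  have g': "good u (\<tau>(v := x))"
    using x assms(2-4) by (intro move[OF g]) (auto simp: A_def)
  have "\<tau> u \<in> X u" using good_in[OF g] assms W_subset by blast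
  with g' x y show ?thesis
    using mult_const[OF g' \<open>u \<in> W\<close> \<open>v \<in> W\<close> \<open>u \<noteq> v\<close>[symmetric], of y "\<tau> u"]
    by (auto simp: A_def a_sym)
qed

text \<open>All nonzero terms of the column sum \<open>col\<close> agree by
  \<open>mult_const\<close>.\<close>

lemma card_A:
  assumes g: "good v \<tau>" and "v \<in> W" "u \<in> W" "u \<noteq> v" and x: "x \<in> A v \<tau> u"
  shows "\<mu> v u = card (A v \<tau> u) * a x (\<tau> u)"
proof -
  have "\<mu> v u = (\<Sum>x\<in>X v. a x (\<tau> u))" using col[OF g] assms W_subset by auto
  also have "\<dots> = (\<Sum>x\<in>A v \<tau> u. a x (\<tau> u))"
    using finite_X assms(2) by (intro sum.mono_neutral_right) (auto simp: A_def)
  also have "\<dots> = (\<Sum>z\<in>A v \<tau> u. a x (\<tau> u))"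
    using mult_const[OF assms(1-4) _ x] by (intro sum.cong) auto
  finally show ?thesis by simp
qed

lemma A_nonempty:
  assumes g: "good v \<tau>" and "E v u"
  shows "\<exists>x. x \<in> A v \<tau> u"
proof (rule ccontr)
  assume "\<not> ?thesis"
  hence "(\<Sum>x\<in>X v. a x (\<tau> u)) = 0" by (auto simp: A_def)
  moreover have "u \<noteq> v" using assms(2) E_irrefl by blast
  ultimately show False using col[OF g, of u] assms(2) W_subset by (auto simp: E_def)
qed

lemma non_nbr_zero:
  assumes g: "good v \<tau>" and "v \<in> W" "u \<in> W" "u \<noteq> v" "\<not> E v u" "x \<in> X v"
  shows "a x (\<tau> u) = 0"
proof -
  have "(\<Sum>x\<in>X v. a x (\<tau> u)) = 0" using col[OF g, of u] assms W_subset by (auto simp: E_def)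
  thus ?thesis using finite_X assms by simp
qed

section \<open>Sending the hole once around an ear\<close>

lemma ear_rev:
  assumes "ear v p" shows "ear v (rev p)"
  using assms is_path_rev[OF symp_E] by (auto simp: ear_def hd_rev last_rev is_path_def)

lemma earD:
  assumes "ear v p"
  shows "v \<in> W" "E v (hd p)" "E v (last p)" "hd p \<noteq> last p" "hd p \<in> W" "last p \<in> W"
    "hd p \<noteq> v" "last p \<noteq> v" "set p \<subseteq> W" "v \<notin> set p"
proof -
  obtain u s q where p: "p = u # s # q"
    using assms by (cases p rule: remdups_adj.cases) (auto simp: ear_def)
  have sub: "set p \<subseteq> W - {v}" "v \<in> W" and "distinct p"
    and iff: "\<forall>x\<in>set p. E v x \<longleftrightarrow> x = hd p \<or> x = last p"
    using assms by (auto simp: ear_def is_path_def)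
  have in_p: "hd p \<in> set p" "last p \<in> set p" by (simp_all add: p)
  have last: "last p = last (s # q)" and ne: "hd p \<noteq> last p"
    using \<open>distinct p\<close> last_in_set[of "s # q"] by (auto simp: p)
  show "v \<in> W" "E v (hd p)" "E v (last p)" "hd p \<noteq> last p" "hd p \<in> W" "last p \<in> W"
    "hd p \<noteq> v" "last p \<noteq> v" "set p \<subseteq> W" "v \<notin> set p"
    using ne last in_p sub iff by auto
qed

text \<open>Each step of the hole along \<open>p\<close> refills the vertex just left, so tokens off
  \<open>butlast p\<close> stay put; the value at \<open>last p\<close>, the final hole, is kept as
  it was.\<close>

lemma shift:
  assumes "good (hd p) \<sigma>" "is_path E W p"
  shows "\<exists>\<sigma>'. good (last p) \<sigma>' \<and> (\<forall>w. w \<notin> set (butlast p) \<longrightarrow> \<sigma>' w = \<sigma> w)"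
  using assms
proof (induction p arbitrary: \<sigma> rule: induct_list012)
  case (3 b c q)
  have E: "E b c" and path: "is_path E W (c # q)" using 3(4) by (auto simp: is_path_def)
  obtain x where x: "x \<in> A b \<sigma> c" using A_nonempty[OF _ E] 3(3) by auto
  have "b \<noteq> c" using E E_irrefl by blast
  hence "good c (\<sigma>(b := x))"
    using move[of b \<sigma> c x] 3(3) E x by (auto simp: E_def A_def)
  then obtain \<sigma>' where
    "good (last (c # q)) \<sigma>'" "\<forall>w. w \<notin> set (butlast (c # q)) \<longrightarrow> \<sigma>' w = (\<sigma>(b := x)) w"
    using 3(2)[of "\<sigma>(b := x)", unfolded list.sel, OF _ path] by blast
  thus ?case by (intro exI[of _ \<sigma>']) auto
qed (auto simp: is_path_def)

text \<open>One full turn of the hole: from \<open>v\<close> to \<open>hd p\<close>, along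
  \<open>p\<close>, and from \<open>last p\<close> back to \<open>v\<close>. The colour
  \<open>x\<close> is left at \<open>v\<close> on departure, and the last move fills
  \<open>last p\<close> with a neighbour of \<open>x\<close>.\<close>

lemma rotate_tokens:
  assumes g: "good v \<tau>" and ear: "ear v p" and y: "y \<in> X (hd p)" "a y (\<tau> (p ! 1)) > 0"
    and x: "x \<in> A v \<tau> (hd p)"
  shows "\<exists>\<tau>'. good v \<tau>' \<and> (\<forall>w. w \<notin> insert v (set p) \<longrightarrow> \<tau>' w = \<tau> w) \<and> \<tau>' (hd p) = y \<and>
     a x (\<tau>' (last p)) > 0"
proof -
  obtain u s q where p: "p = u # s # q"
    using ear by (cases p rule: remdups_adj.cases) (auto simp: ear_def)
  note e = earD[OF ear]
  have path: "is_path E W (s # q)" and us: "E u s" "u \<noteq> s" "u \<notin> set q" "v \<noteq> s" "v \<notin> set q" "v \<noteq> u"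
    using ear by (auto simp: ear_def is_path_def p)
  have "good u (\<tau>(v := x))"
    using move[OF g, of u x] x e by (auto simp: p A_def)
  \<comment> \<open>The colour \<open>y\<close> refills the first vertex; being adjacent to the
    token at \<open>s\<close>, it lets the hole pass on to \<open>s\<close>.\<close>
  hence "good s (\<tau>(v := x, u := y))"
    using move[of u "\<tau>(v := x)" s y] y us by (auto simp: p E_def)
  with shift[of "s # q" "\<tau>(v := x, u := y)"] path obtain \<sigma> where
    \<sigma>: "good (last p) \<sigma>" "\<forall>w. w \<notin> set (butlast (s # q)) \<longrightarrow> \<sigma> w = (\<tau>(v := x, u := y)) w"
    by (auto simp: p)
  have sub: "set (butlast (s # q)) \<subseteq> set (s # q)" by (meson in_set_butlastD subsetI)
  have sv: "\<sigma> v = x" "\<sigma> u = y" using \<sigma>(2) us sub by (auto simp del: butlast.simps)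
  \<comment> \<open>At this moment \<open>v\<close> still carries \<open>x\<close>, so the colour
    \<open>z\<close> that brings the hole home is adjacent to \<open>x\<close>.\<close>
  obtain z where z: "z \<in> A (last p) \<sigma> v" using A_nonempty[OF \<sigma>(1)] e E_sym by blast
  hence "good v (\<sigma>(last p := z))"
    using move[OF \<sigma>(1), of v z] e by (auto simp: A_def)
  moreover have "\<forall>w. w \<notin> insert v (set p) \<longrightarrow> (\<sigma>(last p := z)) w = \<tau> w"
    using \<sigma>(2) sub by (auto simp: p)
  moreover have "(\<sigma>(last p := z)) (hd p) = y" using sv e(4) by (simp add: p)
  moreover have "a x ((\<sigma>(last p := z)) (last p)) > 0" using z sv by (simp add: A_def a_sym)
  ultimately show ?thesis by blast
qed

text \<open>Inner vertices of the ear are not neighbours of \<open>v\<close>, and tokens off the ear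
  agree. So only the two ends can change within a row, whose total is \<open>r\<close> in both
  placements.\<close>

lemma row_balance:
  assumes g: "good v \<tau>" "good v \<tau>'" and ear: "ear v p"
    and eq: "\<forall>w. w \<notin> insert v (set p) \<longrightarrow> \<tau>' w = \<tau> w" and x: "x \<in> X v"
  shows "a x (\<tau> (hd p)) + a x (\<tau> (last p)) = a x (\<tau>' (hd p)) + a x (\<tau>' (last p))"
proof -
  note e = earD[OF ear]
  have *: "r = a x (\<rho> (hd p)) + (a x (\<rho> (last p)) +
      (\<Sum>w\<in>V - {v} - {hd p} - {last p}. a x (\<rho> w)))" if "good v \<rho>" for \<rho>
  proof -
    have "r = (\<Sum>w\<in>V - {v}. a x (\<rho> w))" using row[OF that e(1) x] by simp
    also have "\<dots> = a x (\<rho> (hd p)) + (\<Sum>w\<in>V - {v} - {hd p}. a x (\<rho> w))"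
      using finite_V W_subset e by (subst sum.remove[of _ "hd p"]) auto
    also have "(\<Sum>w\<in>V - {v} - {hd p}. a x (\<rho> w)) =
      a x (\<rho> (last p)) + (\<Sum>w\<in>V - {v} - {hd p} - {last p}. a x (\<rho> w))"
      using finite_V W_subset e by (subst sum.remove[of _ "last p"]) auto
    finally show ?thesis .
  qed
  have "(\<Sum>w\<in>V - {v} - {hd p} - {last p}. a x (\<tau> w)) = (\<Sum>w\<in>V - {v} - {hd p} - {last p}. a x (\<tau>' w))"
  proof (intro sum.cong refl)
    fix w assume w: "w \<in> V - {v} - {hd p} - {last p}"
    show "a x (\<tau> w) = a x (\<tau>' w)"
    proof (cases "w \<in> set p")
      case True
      hence "\<not> E v w" "w \<in> W" using ear w e by (auto simp: ear_def)
      thus ?thesis using non_nbr_zero[OF g(1)] non_nbr_zero[OF g(2)] w x e by auto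
    qed (use eq w in auto)
  qed
  with *[OF g(1)] *[OF g(2)] show ?thesis by linarith
qed

text \<open>With the hole moved to \<open>hd p\<close>, the vertex \<open>p ! 1\<close> is a
  neighbour of the hole, and its token has not moved.\<close>

lemma next_token:
  assumes g: "good v \<tau>" and ear: "ear v p"
  shows "\<exists>y. y \<in> X (hd p) \<and> a y (\<tau> (p ! 1)) > 0"
proof -
  obtain u s q where p: "p = u # s # q"
    using ear by (cases p rule: remdups_adj.cases) (auto simp: ear_def)
  note e = earD[OF ear]
  obtain x where "x \<in> A v \<tau> u" using A_nonempty[OF g] e by (auto simp: p)
  hence "good u (\<tau>(v := x))"
    using move[OF g, of u x] e by (auto simp: p A_def)
  from A_nonempty[OF this, of s] ear show ?thesis
    by (auto simp: ear_def is_path_def p A_def)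
qed

text \<open>Balance the row of \<open>x\<close>: were \<open>y\<close> adjacent to \<open>x\<close>,
  it would take up the whole multiplicity \<open>a x (\<tau> (hd p))\<close> and leave nothing for
  the new last token, which is adjacent to \<open>x\<close>. Since \<open>y\<close> misses
  \<open>x\<close>, it misses all of \<open>A v \<tau> (hd p)\<close> by
  \<open>nbr_const\<close>.\<close>

lemma rotate_split:
  assumes g: "good v \<tau>" and ear: "ear v p" and y: "y \<in> X (hd p)"
    and x: "x \<in> A v \<tau> (hd p)" "x \<notin> A v \<tau> (last p)"
    and g': "good v \<tau>'" "\<forall>w. w \<notin> insert v (set p) \<longrightarrow> \<tau>' w = \<tau> w" "\<tau>' (hd p) = y"
      "a x (\<tau>' (last p)) > 0"
  shows "A v \<tau> (hd p) \<subseteq> A v \<tau>' (last p)" "A v \<tau> (hd p) \<inter> A v \<tau> (last p) = {}"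
    "\<And>z. z \<in> A v \<tau> (hd p) \<Longrightarrow> a z y = 0"
    "a x (\<tau> (hd p)) = a x (\<tau>' (last p))"
proof -
  note e = earD[OF ear]
  note bal = row_balance[OF g g'(1) ear g'(2), unfolded g'(3)]
  have xX: "x \<in> X v" using x by (simp add: A_def)
  have eq: "a x (\<tau> (hd p)) = a x y + a x (\<tau>' (last p))"
    using bal[OF xX] x by (simp add: A_def)
  have "a x y = 0"
  proof (rule ccontr)
    assume "a x y \<noteq> 0"
    with mult_const'[OF g e(1,5,7) x(1) y] eq g'(4) show False by simp
  qed
  with eq show c: "a x (\<tau> (hd p)) = a x (\<tau>' (last p))" by simp
  show zero: "a z y = 0" if "z \<in> A v \<tau> (hd p)" for z
    using nbr_const[OF g e(1,5,7) x(1) that y] \<open>a x y = 0\<close> by (simp add: a_sym)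
  have xA: "x \<in> A v \<tau>' (last p)" using xX g'(4) by (simp add: A_def)
  \<comment> \<open>For \<open>z\<close> in the first set the multiplicities to the old first and
    the new last token are those of \<open>x\<close>, hence equal; the balance then leaves zero for
    the old last token.\<close>
  have *: "z \<in> A v \<tau>' (last p) \<and> z \<notin> A v \<tau> (last p)" if z: "z \<in> A v \<tau> (hd p)" for z
  proof -
    have zX: "z \<in> X v" using z by (simp add: A_def)
    have b: "a z (\<tau> (hd p)) + a z (\<tau> (last p)) = a z (\<tau>' (last p))"
      using bal[OF zX] zero[OF z] by simp
    have "a z (\<tau> (hd p)) = a x (\<tau> (hd p))" by (rule mult_const[OF g e(1,5,7) z x(1)])
    moreover have zA: "z \<in> A v \<tau>' (last p)" using b z zX by (simp add: A_def)
    moreover have "a z (\<tau>' (last p)) = a x (\<tau>' (last p))"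
      by (rule mult_const[OF g'(1) e(1,6,8) zA xA])
    ultimately show ?thesis using b c by (simp add: A_def)
  qed
  show "A v \<tau> (hd p) \<subseteq> A v \<tau>' (last p)" "A v \<tau> (hd p) \<inter> A v \<tau> (last p) = {}"
    using * by auto
qed

lemma finite_A: "v \<in> W \<Longrightarrow> finite (A v \<tau> u)"
  using finite_X by (simp add: A_def)

text \<open>Both values of \<open>\<mu>\<close> are the size of a colour set times one common
  multiplicity, and the set at \<open>hd p\<close> is contained in the rotated set at
  \<open>last p\<close>.\<close>

lemma split_ear_le:
  assumes g: "good v \<tau>" and ear: "ear v p" and x: "x \<in> A v \<tau> (hd p)" "x \<notin> A v \<tau> (last p)"
  shows "A v \<tau> (hd p) \<inter> A v \<tau> (last p) = {}" "\<mu> v (hd p) \<le> \<mu> v (last p)"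
proof -
  note e = earD[OF ear]
  obtain y where y: "y \<in> X (hd p)" "a y (\<tau> (p ! 1)) > 0" using next_token[OF g ear] by blast
  obtain \<tau>' where g': "good v \<tau>'" "\<forall>w. w \<notin> insert v (set p) \<longrightarrow> \<tau>' w = \<tau> w" "\<tau>' (hd p) = y"
      "a x (\<tau>' (last p)) > 0"
    using rotate_tokens[OF g ear y x(1)] by blast
  note s = rotate_split[OF g ear y(1) x g']
  show "A v \<tau> (hd p) \<inter> A v \<tau> (last p) = {}" by (fact s(2))
  have "x \<in> A v \<tau>' (last p)" using s(1) x by blast
  hence "\<mu> v (last p) = card (A v \<tau>' (last p)) * a x (\<tau> (hd p))"
    using card_A[OF g'(1) e(1,6,8)] s(4) by simp
  moreover have "card (A v \<tau> (hd p)) \<le> card (A v \<tau>' (last p))"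
    using s(1) finite_A e(1) by (intro card_mono) auto
  ultimately show "\<mu> v (hd p) \<le> \<mu> v (last p)"
    using card_A[OF g e(1,5,7) x(1)] by simp
qed

text \<open>The one-sided inequality is applied to the ear and to its reverse.\<close>

lemma split_ear:
  assumes g: "good v \<tau>" and ear: "ear v p" and ne: "A v \<tau> (hd p) \<noteq> A v \<tau> (last p)"
  shows "A v \<tau> (hd p) \<inter> A v \<tau> (last p) = {}" "\<mu> v (hd p) = \<mu> v (last p)"
proof -
  note e = earD[OF ear]
  have [simp]: "hd (rev p) = last p" "last (rev p) = hd p"
    by (simp_all add: hd_rev last_rev)
  note f = split_ear_le[OF g ear] and b = split_ear_le[OF g ear_rev[OF ear], simplified]
  show disj: "A v \<tau> (hd p) \<inter> A v \<tau> (last p) = {}"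
    using ne f(1) b(1) by blast
  obtain x y where "x \<in> A v \<tau> (hd p)" "y \<in> A v \<tau> (last p)"
    using A_nonempty[OF g] e by blast
  with disj f(2)[of x] b(2)[of y] show "\<mu> v (hd p) = \<mu> v (last p)" by force
qed

text \<open>If the end sets differ, equality of \<open>\<mu>\<close> at the two ends upgrades the
  inclusion of \<open>rotate_split\<close> to an equality, and the row balance settles the other
  set. If they coincide, the multiplicities at both ends are unchanged and so are the sets.\<close>

lemma rotate_swap:
  assumes g: "good v \<tau>" and ear: "ear v p" and y: "y \<in> X (hd p)" "a y (\<tau> (p ! 1)) > 0"
  shows "\<exists>\<tau>'. good v \<tau>' \<and> (\<forall>w. w \<notin> insert v (set p) \<longrightarrow> \<tau>' w = \<tau> w) \<and> \<tau>' (hd p) = y \<and>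
     A v \<tau>' (hd p) = A v \<tau> (last p) \<and> A v \<tau>' (last p) = A v \<tau> (hd p)"
proof -
  note e = earD[OF ear]
  obtain x where x: "x \<in> A v \<tau> (hd p)" using A_nonempty[OF g] e by blast
  obtain \<tau>' where g': "good v \<tau>'" "\<forall>w. w \<notin> insert v (set p) \<longrightarrow> \<tau>' w = \<tau> w" "\<tau>' (hd p) = y"
      "a x (\<tau>' (last p)) > 0"
    using rotate_tokens[OF g ear y x] by blast
  note bal = row_balance[OF g g'(1) ear g'(2), unfolded g'(3)]
  have xX: "x \<in> X v" using x by (simp add: A_def)
  have "A v \<tau>' (hd p) = A v \<tau> (last p) \<and> A v \<tau>' (last p) = A v \<tau> (hd p)"
  proof (cases "A v \<tau> (hd p) = A v \<tau> (last p)")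
    case False
    note disj = split_ear[OF g ear False]
    have x': "x \<notin> A v \<tau> (last p)" using disj x by blast
    note s = rotate_split[OF g ear y(1) x x' g']
    have xA: "x \<in> A v \<tau>' (last p)" using s(1) x by blast
    have "card (A v \<tau> (hd p)) * a x (\<tau> (hd p)) = card (A v \<tau>' (last p)) * a x (\<tau> (hd p))"
      using card_A[OF g'(1) e(1,6,8) xA] card_A[OF g e(1,5,7) x] disj(2) s(4) by metis
    moreover have "a x (\<tau> (hd p)) > 0" using x by (simp add: A_def)
    ultimately have 1: "A v \<tau> (hd p) = A v \<tau>' (last p)"
      using s(1) finite_A[OF e(1)] by (intro card_subset_eq) auto
    have "z \<in> A v \<tau>' (hd p) \<longleftrightarrow> z \<in> A v \<tau> (last p)" if z: "z \<in> X v" for z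
    proof -
      have "z \<in> A v \<tau> (hd p) \<longleftrightarrow> z \<in> A v \<tau>' (last p)" "z \<in> A v \<tau> (hd p) \<longrightarrow> z \<notin> A v \<tau> (last p)"
        "z \<in> A v \<tau> (hd p) \<longrightarrow> a z y = 0"
        using 1 disj(1) s(3) by blast+
      thus ?thesis using bal[OF z] z unfolding A_def g'(3) mem_Collect_eq by linarith
    qed
    thus ?thesis using 1 by (auto simp: A_def)
  next
    case True
    have xl: "x \<in> A v \<tau> (last p)" using x True by simp
    have last_in: "\<tau>' (last p) \<in> X (last p)" using good_in[OF g'(1)] e W_subset by blast
    have "a x (\<tau>' (last p)) = a x (\<tau> (last p))"
      by (rule mult_const'[OF g e(1,6,8) xl last_in g'(4)])
    \<comment> \<open>The new last token has the same multiplicity to \<open>x\<close> as the old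
      one, so the row balance forces the same at the other end.\<close>
    with bal[OF xX] have xy: "a x y = a x (\<tau> (hd p))" by simp
    have *: "a z y = a z (\<tau> (hd p))" if z: "z \<in> A v \<tau> (hd p)" for z
      using nbr_const[OF g e(1,5,7) x z y(1)] mult_const[OF g e(1,5,7) x z] xy by (simp add: a_sym)
    have "(z \<in> A v \<tau>' (hd p) \<longleftrightarrow> z \<in> A v \<tau> (hd p)) \<and> (z \<in> A v \<tau>' (last p) \<longleftrightarrow> z \<in> A v \<tau> (hd p))"
      if z: "z \<in> X v" for z
    proof (cases "z \<in> A v \<tau> (hd p)")
      case zA: True
      hence "z \<in> A v \<tau> (last p)" using True by simp
      thus ?thesis using *[OF zA] bal[OF z] zA by (auto simp: A_def g'(3))
    next
      case False
      hence "z \<notin> A v \<tau> (last p)" using True by simp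
      thus ?thesis using bal[OF z] z False by (auto simp: A_def g'(3))
    qed
    thus ?thesis using True by (auto simp: A_def)
  qed
  thus ?thesis using g' by blast
qed

text \<open>The condition on \<open>y\<close> involves \<open>\<tau>\<close> only through the token
  at \<open>p ! 1\<close>. Hence good placements with hole \<open>v\<close> that agree there have
  the same colour set at \<open>last p\<close>.\<close>

lemma second_token_determines_last:
  assumes "good v \<tau>" "ear v p" "y \<in> X (hd p)" "a y (\<tau> (p ! 1)) > 0"
  shows "{x \<in> X v. a x y > 0} = A v \<tau> (last p)"
proof -
  obtain \<tau>' where "\<tau>' (hd p) = y" "A v \<tau>' (hd p) = A v \<tau> (last p)"
    using rotate_swap[OF assms] by blast
  thus ?thesis by (simp add: A_def)
qed

end

section \<open>Blocks of sliding tokens\<close>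

text \<open>The two assumptions are nonseparability of the block in terms of \<open>reach\<close>; a
  single vertex satisfies the second one vacuously.\<close>

locale block_token_system = token_system +
  assumes conn: "x \<in> W \<Longrightarrow> y \<in> W \<Longrightarrow> reach E W x y"
    and conn_del: "v \<in> W \<Longrightarrow> x \<in> W - {v} \<Longrightarrow> y \<in> W - {v} \<Longrightarrow> reach E (W - {v}) x y"
begin

section \<open>Split vertices and how they spread\<close>

text \<open>This is the dichotomy of the proof. One such vertex makes all of \<open>W\<close> split
  and leads to bricks; without any, the block is a multiple of a graph read off from the
  colours.\<close>

definition split_at :: "'a \<Rightarrow> bool" where
  "split_at v \<longleftrightarrow> (\<exists>\<tau> u w. good v \<tau> \<and> E v u \<and> E v w \<and> A v \<tau> u \<noteq> A v \<tau> w)"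

definition ear_ends :: "'a \<Rightarrow> 'a \<Rightarrow> 'a \<Rightarrow> bool" where
  "ear_ends v u w \<longleftrightarrow> (\<exists>p. ear v p \<and> hd p = u \<and> last p = w)"

lemma first_ear:
  assumes p: "is_path E (W - {v}) (u # xs)" and v: "v \<in> W" "E v u" and ex: "\<exists>z\<in>set xs. E v z"
  shows "\<exists>ys z zs. xs = ys @ z # zs \<and> ear v (u # ys @ [z])"
proof -
  obtain ys z zs where s: "xs = ys @ z # zs" "E v z" "\<forall>y\<in>set ys. \<not> E v y"
    using split_list_first_propE[OF ex] by metis
  have "is_path E (W - {v}) (u # ys @ [z])"
    using is_path_appendD(1)[of E "W - {v}" "u # ys @ [z]" zs] p by (simp add: s)
  hence "ear v (u # ys @ [z])" using s v by (auto simp: ear_def is_path_def)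
  thus ?thesis using s by blast
qed

text \<open>The neighbours of \<open>v\<close> met along the path cut it into consecutive
  ears.\<close>

lemma ear_ends_path:
  assumes "is_path E (W - {v}) p" "v \<in> W" "E v (hd p)" "E v (last p)"
  shows "(ear_ends v)\<^sup>*\<^sup>* (hd p) (last p)"
  using assms
proof (induction p rule: length_induct)
  case (1 p)
  then obtain u xs where p: "p = u # xs" by (cases p) (auto simp: is_path_def)
  show ?case
  proof (cases "xs = []")
    case False
    hence "\<exists>z\<in>set xs. E v z" using 1(5) by (auto simp: p)
    then obtain ys z zs where e: "xs = ys @ z # zs" "ear v (u # ys @ [z])"
      using first_ear 1(2-4) unfolding p by (metis list.sel(1))
    have "ear_ends v u z" using e(2) by (auto simp: ear_ends_def)
    moreover have "(ear_ends v)\<^sup>*\<^sup>* (hd (z # zs)) (last (z # zs))"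
    proof (rule 1(1)[rule_format])
      show "length (z # zs) < length p" by (simp add: p e)
      show "is_path E (W - {v}) (z # zs)"
        using is_path_appendD(2)[of E "W - {v}" "u # ys" "z # zs"] 1(2) by (simp add: p e)
      show "E v (hd (z # zs))" using earD(3)[OF e(2)] by simp
      show "E v (last (z # zs))" using 1(5) by (simp add: p e)
    qed (fact 1)
    ultimately show ?thesis by (simp add: p e converse_rtranclp_into_rtranclp)
  qed (simp add: p)
qed

lemma ear_ends_connected:
  assumes "E v u" "E v w"
  shows "(ear_ends v)\<^sup>*\<^sup>* u w"
proof -
  have "u \<in> W - {v}" "w \<in> W - {v}" "v \<in> W" using assms E_irrefl by (auto simp: E_def)
  from reach_imp_path[OF conn_del[OF this(3,1,2)] this(1)] ear_ends_path \<open>v \<in> W\<close> assms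
  show ?thesis by blast
qed

lemma swap:
  assumes "good v \<tau>" "ear v p"
  shows "\<exists>\<tau>'. good v \<tau>' \<and> (\<forall>w. w \<notin> insert v (set p) \<longrightarrow> \<tau>' w = \<tau> w) \<and>
     A v \<tau>' (hd p) = A v \<tau> (last p) \<and> A v \<tau>' (last p) = A v \<tau> (hd p)"
  using next_token[OF assms] rotate_swap[OF assms] by blast

text \<open>If the ends \<open>u\<close>, \<open>w\<close> of one ear had equal sets in all
  placements, the equality would spread along ears to every neighbour of \<open>v\<close>: an ear
  ending at an exceptional \<open>q'\<close> could be swapped, which would break the equality
  already known at its other end.\<close>

lemma split_every_ear:
  assumes sp: "split_at v" and ear: "ear v p"
  shows "\<exists>\<tau>. good v \<tau> \<and> A v \<tau> (hd p) \<noteq> A v \<tau> (last p)"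
proof (rule ccontr)
  define u w where "u = hd p" "w = last p"
  assume "\<not> ?thesis"
  hence eq: "A v \<tau> u = A v \<tau> w" if "good v \<tau>" for \<tau> using that by (auto simp: u_w_def)
  note e = earD[OF ear, folded u_w_def]
  have all: "\<forall>\<tau>. good v \<tau> \<longrightarrow> A v \<tau> q = A v \<tau> u" if "(ear_ends v)\<^sup>*\<^sup>* u q" for q
    using that
  proof (induction rule: rtranclp_induct)
    case (step q q')
    obtain c where c: "ear v c" "hd c = q" "last c = q'" using step(2) by (auto simp: ear_ends_def)
    show ?case
    proof (intro allI impI, rule ccontr)
      fix \<tau> assume g: "good v \<tau>" and ne: "A v \<tau> q' \<noteq> A v \<tau> u"
      obtain \<tau>' where g': "good v \<tau>'" "\<forall>w. w \<notin> insert v (set c) \<longrightarrow> \<tau>' w = \<tau> w"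
        "A v \<tau>' q = A v \<tau> q'" "A v \<tau>' q' = A v \<tau> q"
        using swap[OF g c(1)] c by auto
      have other: "A v \<tau>' z = A v \<tau> z" if "E v z" "z \<noteq> q" "z \<noteq> q'" for z
      proof -
        have "z \<notin> set c" using c that by (auto simp: ear_def)
        moreover have "z \<noteq> v" using that E_irrefl by blast
        ultimately show ?thesis using g'(2) by (simp add: A_def)
      qed
      \<comment> \<open>Both \<open>u\<close> and \<open>w\<close> differ from \<open>q'\<close>,
        and at least one of them differs from \<open>q\<close>; that one keeps its set in the swap,
        while \<open>q\<close> receives the set of \<open>q'\<close>.\<close>
      show False
        using other[of u] other[of w] step(3) eq g g' ne e(2,3,4) by metis
    qed
  qed simp
  from sp obtain \<tau> y z where "good v \<tau>" "E v y" "E v z" "A v \<tau> y \<noteq> A v \<tau> z"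
    by (auto simp: split_at_def)
  thus False using all ear_ends_connected e(2) by metis
qed

lemma split_ear_from:
  assumes "split_at v" "E v u"
  shows "\<exists>p. ear v p \<and> hd p = u"
proof -
  obtain w where "E v w" "w \<noteq> u" using assms by (auto simp: split_at_def)
  then obtain z where "ear_ends v u z"
    using ear_ends_connected[OF assms(2), of w] by (metis converse_rtranclpE)
  thus ?thesis by (auto simp: ear_ends_def)
qed

lemma split_mult_eq:
  assumes "split_at v" "E v u" "E v w"
  shows "\<mu> v u = \<mu> v w"
  using ear_ends_connected[OF assms(2,3)]
proof (induction rule: rtranclp_induct)
  case (step y z)
  then obtain p where p: "ear v p" "hd p = y" "last p = z" by (auto simp: ear_ends_def)
  from split_every_ear[OF assms(1) p(1)] split_ear(2)[OF _ p(1)] step p show ?case by metis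
qed simp

text \<open>Move the hole to \<open>u\<close> by a colour \<open>x\<close> outside
  \<open>A v \<tau> (last p)\<close>. The colours of \<open>u\<close> adjacent to the token at
  \<open>s\<close> miss \<open>x\<close>, because their neighbours in \<open>X v\<close> are exactly
  \<open>A v \<tau> (last p)\<close>. So \<open>u\<close> sees different sets at \<open>s\<close>
  and at \<open>v\<close>.\<close>

lemma split_nbr:
  assumes "split_at v" "E v u"
  shows "split_at u"
proof -
  obtain p where ear: "ear v p" and hd: "hd p = u" using split_ear_from[OF assms] by blast
  then obtain s q where p: "p = u # s # q"
    by (cases p rule: remdups_adj.cases) (auto simp: ear_def)
  note e = earD[OF ear]
  obtain \<tau> where g: "good v \<tau>" and ne: "A v \<tau> u \<noteq> A v \<tau> (last p)"
    using split_every_ear[OF assms(1) ear] hd by blast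
  obtain x where x: "x \<in> A v \<tau> u" using A_nonempty[OF g assms(2)] by blast
  have x': "x \<notin> A v \<tau> (last p)" using split_ear(1)[OF g ear] ne x hd by blast
  have g': "good u (\<tau>(v := x))" using move[OF g, of u x] x e hd by (auto simp: A_def)
  obtain y where y: "y \<in> X u" "a y (\<tau> s) > 0" using next_token[OF g ear] by (auto simp: p)
  have "{z \<in> X v. a z y > 0} = A v \<tau> (last p)"
    using second_token_determines_last[OF g ear] y by (simp add: p)
  hence "x \<notin> {z \<in> X v. a z y > 0}" using x' by simp
  hence "a x y = 0" using x by (simp add: A_def)
  moreover have "s \<noteq> v" "E u s" using ear by (auto simp: p ear_def is_path_def)
  ultimately have "y \<in> A u (\<tau>(v := x)) s" "y \<notin> A u (\<tau>(v := x)) v"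
    using y by (auto simp: A_def a_sym)
  thus ?thesis using g' \<open>E u s\<close> E_sym[OF assms(2)] unfolding split_at_def by blast
qed

lemma split_all:
  assumes "split_at v" "u \<in> W"
  shows "split_at u"
proof -
  have "v \<in> W" using assms(1) by (auto simp: split_at_def E_def)
  from conn[OF this assms(2)] show ?thesis unfolding reach_def
    by (induction rule: rtranclp_induct) (use assms(1) split_nbr in auto)
qed

text \<open>All multiplicities at one split vertex agree, and symmetry of \<open>\<mu>\<close>
  carries the common value across an edge to the next vertex.\<close>

lemma split_mult_const:
  assumes "split_at v"
  shows "\<exists>t\<ge>1. \<forall>u w. E u w \<longrightarrow> \<mu> u w = t"
proof -
  obtain w0 where w0: "E v w0" using assms by (auto simp: split_at_def)
  have *: "\<forall>w. E u w \<longrightarrow> \<mu> u w = \<mu> v w0" if "u \<in> W" for u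
  proof -
    have "v \<in> W" using w0 by (simp add: E_def)
    from conn[OF this that] show ?thesis unfolding reach_def
    proof (induction rule: rtranclp_induct)
      case base show ?case using split_mult_eq[OF assms] w0 by blast
    next
      case (step y z)
      hence "\<mu> z y = \<mu> v w0" using \<mu>_sym by auto
      thus ?case using split_mult_eq[OF split_all[OF assms, of z]] step E_sym by metis
    qed
  qed
  show ?thesis using * w0 by (intro exI[of _ "\<mu> v w0"]) (auto simp: E_def Suc_leI)
qed

text \<open>Otherwise swapping along an ear that avoids the second vertex of \<open>p\<close> would change the
  class of the last token, which the second token determines.\<close>

lemma ear_separates:
  assumes sp: "split_at v" and ear: "ear v p" and len: "length p \<ge> 3" and z: "E v z" "z \<noteq> last p"
  shows "\<not> reach E (W - {v, p ! 1}) (last p) z"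
proof
  assume r: "reach E (W - {v, p ! 1}) (last p) z"
  note e = earD[OF ear]
  obtain u s q where p1: "p = u # s # q"
    using len by (cases p rule: remdups_adj.cases) auto
  have "q \<noteq> []" using len by (auto simp: p1)
  note p = p1 this
  have "last p \<in> set q" by (simp add: p)
  moreover have "s \<notin> set q" using ear by (simp add: p ear_def is_path_def)
  ultimately have "last p \<in> W - {v, p ! 1}" using e by (auto simp: p)
  then obtain c where c: "is_path E (W - {v, p ! 1}) c" "hd c = last p" "last c = z"
    using reach_imp_path[OF r] by blast
  then obtain xs where xs: "c = last p # xs" by (cases c) (auto simp: is_path_def)
  have "z \<in> set xs" using c z by (auto simp: xs split: if_splits)
  hence "\<exists>z\<in>set xs. E v z" using z by blast
  moreover have "is_path E (W - {v}) (last p # xs)"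
    using c by (auto simp: xs is_path_def)
  \<comment> \<open>The initial piece of \<open>c\<close> up to the next neighbour of
    \<open>v\<close> is an ear that avoids \<open>p ! 1\<close>.\<close>
  ultimately obtain ys z' zs where ys: "xs = ys @ z' # zs" "ear v (last p # ys @ [z'])"
    using first_ear e by blast
  obtain \<tau> where g: "good v \<tau>" and ne: "A v \<tau> (last p) \<noteq> A v \<tau> z'"
    using split_every_ear[OF sp ys(2)] by auto
  obtain \<tau>' where g': "good v \<tau>'" "\<forall>w. w \<notin> insert v (set (last p # ys @ [z'])) \<longrightarrow> \<tau>' w = \<tau> w"
    "A v \<tau>' (last p) = A v \<tau> z'"
    using swap[OF g ys(2)] by auto
  have "p ! 1 \<notin> insert v (set (last p # ys @ [z']))"
    using c(1) ear by (auto simp: xs ys is_path_def p ear_def)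
  hence same: "\<tau>' (p ! 1) = \<tau> (p ! 1)" using g'(2) by blast
  obtain y where y: "y \<in> X (hd p)" "a y (\<tau> (p ! 1)) > 0" using next_token[OF g ear] by blast
  have "A v \<tau> (last p) = A v \<tau>' (last p)"
    using second_token_determines_last[OF g ear y]
      second_token_determines_last[OF g'(1) ear y(1)] y(2) same by simp
  thus False using ne g'(3) by simp
qed

section \<open>Shape of a block with split vertices\<close>

text \<open>Deleting \<open>u\<close> leaves a path from \<open>s\<close> to \<open>v\<close>; its
  part up to the first neighbour of \<open>v\<close>, preceded by \<open>u\<close>, is the ear. As
  \<open>s\<close> is not a neighbour of \<open>v\<close>, this ear has at least three
  vertices.\<close>

lemma ear_of_distance_two:
  assumes "E v u" "E u s" "s \<noteq> v" "\<not> E v s"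
  shows "\<exists>q. q \<noteq> [] \<and> ear v (u # s # q)"
proof -
  have in_W: "u \<in> W" "s \<in> W - {u}" "v \<in> W - {u}"
    using assms E_irrefl by (auto simp: E_def)
  obtain c where c: "is_path E (W - {u}) c" "hd c = s" "last c = v"
    using reach_imp_path[OF conn_del[OF in_W] in_W(2)] by blast
  define d where "d = butlast c"
  have cd: "c = d @ [v]" using append_butlast_last_id[of c] c by (simp add: d_def is_path_def)
  have "d \<noteq> []" using c assms by (auto simp: cd)
  hence "E (last d) v" using c(1) by (simp add: cd is_path_def successively_append_iff)
  hence "\<exists>w\<in>set d. E v w" using E_sym \<open>d \<noteq> []\<close> by (meson last_in_set)
  then obtain ys w zs where s: "d = ys @ w # zs" "E v w" "\<forall>y\<in>set ys. \<not> E v y"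
    by (elim split_list_first_propE) metis
  have "hd d = s" using c \<open>d \<noteq> []\<close> by (simp add: cd)
  then obtain ys' where ys: "ys = s # ys'" using s assms by (cases ys) auto
  have "is_path E (W - {u}) (ys @ [w])"
    using is_path_appendD(1)[of E "W - {u}" "ys @ [w]" "zs @ [v]"] c(1) by (simp add: cd s)
  moreover have "v \<notin> set (ys @ [w])" using c(1) by (auto simp: cd s is_path_def)
  ultimately have "is_path E (W - {v}) (u # s # ys' @ [w])"
    using assms E_irrefl in_W by (auto simp: is_path_def ys)
  hence "ear v (u # s # ys' @ [w])"
    using s assms in_W by (auto simp: ear_def ys is_path_def)
  thus ?thesis by blast
qed

text \<open>Otherwise \<open>v\<close> and its neighbours would be closed under adjacency and
  exhaust \<open>W\<close>.\<close>

lemma ex_distance_two: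
  assumes "v \<in> W" "s \<in> W" "s \<noteq> v" "\<not> E v s"
  shows "\<exists>u s'. E v u \<and> E u s' \<and> s' \<noteq> v \<and> \<not> E v s'"
proof (rule ccontr)
  assume no: "\<not> ?thesis"
  have "y = v \<or> E v y" if "reach E W v y" for y
    using that unfolding reach_def by (induction rule: rtranclp_induct) (use no in blast)+
  thus False using conn[OF assms(1,2)] assms by blast
qed

text \<open>Applied to an ear \<open>p\<close> and to its reverse, \<open>ear_separates\<close> cuts
  each end of \<open>p\<close> off from any third neighbour \<open>z\<close> of \<open>v\<close>
  once \<open>v\<close> and the second vertex from the opposite end resp. its mirror image are
  deleted. A path from \<open>z\<close> that first meets \<open>p\<close> in \<open>b\<close>
  contradicts one of these separations or, when \<open>p\<close> has three vertices, one at
  \<open>u\<close>.\<close>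

lemma split_two_nbrs:
  assumes sp: "split_at v" and s0: "s0 \<in> W" "s0 \<noteq> v" "\<not> E v s0"
  shows "\<exists>u w. u \<noteq> w \<and> {z. E v z} = {u, w}"
proof -
  have "v \<in> W" using sp by (auto simp: split_at_def E_def)
  then obtain u s where us: "E v u" "E u s" "s \<noteq> v" "\<not> E v s"
    using ex_distance_two s0 by blast
  then obtain q where q: "q \<noteq> []" and ear: "ear v (u # s # q)" using ear_of_distance_two by blast
  define p where "p = u # s # q"
  define w where "w = last q"
  have ear: "ear v p" using ear by (simp add: p_def)
  have hl: "hd p = u" "last p = w" using q by (simp_all add: p_def w_def)
  note e = earD[OF ear, unfolded hl]
  have wq: "w \<in> set q" using q by (simp add: w_def)
  have dist: "distinct p" and pw: "is_path E (W - {v}) p" using ear by (auto simp: ear_def is_path_def)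
  have len: "length p \<ge> 3" using q by (cases q) (auto simp: p_def)
  have sepw: "\<not> reach E (W - {v, s}) w z" if "E v z" "z \<noteq> w" for z
    using ear_separates[OF sp ear len that(1)] that hl by (simp add: p_def)
  \<comment> \<open>This is the second vertex of the reversed ear, the last but one of
    \<open>p\<close>; it equals \<open>s\<close> when \<open>p\<close> has three vertices.\<close>
  define s' where "s' = rev p ! 1"
  have sepu: "\<not> reach E (W - {v, s'}) u z" if "E v z" "z \<noteq> u" for z
    using ear_separates[OF sp ear_rev[OF ear], of z] that hl len
    by (simp add: s'_def last_rev)
  have i: "s' = p ! (length p - 2)" using len by (simp add: s'_def rev_nth numeral_2_eq_2)
  have s': "s' \<in> set p" "s' \<noteq> u" "s' \<noteq> w"
  proof -
    have "u = p ! 0" "w = p ! (length p - 1)" using len hl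
      by (auto simp: last_conv_nth hd_conv_nth p_def)
    moreover have "p ! (length p - 2) = p ! j \<longleftrightarrow> length p - 2 = j" if "j < length p" for j
      using that len by (intro nth_eq_iff_index_eq[OF dist]) auto
    moreover have "0 < length p" "length p - 1 < length p" "length p - 2 < length p"
      "length p - 2 \<noteq> 0" "length p - 2 \<noteq> length p - 1"
      using len by auto
    ultimately show "s' \<in> set p" "s' \<noteq> u" "s' \<noteq> w"
      using i by (metis nth_mem)+
  qed
  have "z = u \<or> z = w" if z: "E v z" for z
  proof (rule ccontr)
    assume "\<not> ?thesis"
    hence zn: "z \<noteq> u" "z \<noteq> w" by auto
    have zp: "z \<notin> set p" using ear z zn hl by (auto simp: ear_def)
    have zW: "z \<in> W - {v}" "s \<in> W - {v}" using z us E_irrefl by (auto simp: E_def)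
    obtain c where c: "is_path E (W - {v}) c" "hd c = z" "last c = s"
      using reach_imp_path[OF conn_del[OF \<open>v \<in> W\<close> zW] zW(1)] by blast
    have "\<exists>y\<in>set c. y \<in> set p" using c by (intro bexI[of _ s]) (auto simp: p_def is_path_def)
    then obtain ys b zs where b: "c = ys @ b # zs" "b \<in> set p" "\<forall>y\<in>set ys. y \<notin> set p"
      by (elim split_list_first_propE) metis
    have ysb: "is_path E (W - {v}) (ys @ [b])"
      using is_path_appendD(1)[of E "W - {v}" "ys @ [b]" zs] c(1) by (simp add: b)
    have hdz: "hd (ys @ [b]) = z" using c(2) by (cases ys) (auto simp: b)
    have zb: "reach E (W - {v} - (set p - {b})) z b"
    proof -
      have "is_path E (W - {v} - (set p - {b})) (ys @ [b])"
        using ysb b by (auto simp: is_path_def)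
      from path_imp_reach[OF this] show ?thesis using hdz by simp
    qed
    have to_b: "reach E S b z" if "W - {v} - (set p - {b}) \<subseteq> S" for S
      using reach_sym[OF symp_E zb] that by (rule reach_mono)
    show False
    proof (cases "b = u")
      case True
      have "reach E (W - {v, s'}) u z" using to_b[of "W - {v, s'}"] True s' by auto
      thus False using sepu[OF z zn(1)] by blast
    next
      case bu: False
      show False
      proof (cases "b = s")
        case bs: True
        show False
        proof (cases "s = s'")
          case False
          have "reach E (W - {v, s'}) u s"
            using us E_irrefl s' False e by (intro reach_edge) (auto simp: E_def)
          moreover have "reach E (W - {v, s'}) s z"
            using to_b[of "W - {v, s'}"] s' bs False by auto
          ultimately have "reach E (W - {v, s'}) u z" by (rule reach_trans)
          thus False using sepu[OF z zn(1)] by blast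
        next
          case True
          \<comment> \<open>Here the ear has length three, and it is the four-cycle seen from \<open>u\<close> that separates.\<close>
          have "p ! 1 = p ! (length p - 2)"
            using True i by (simp add: p_def)
          hence "length p - 2 = 1" using nth_eq_iff_index_eq[OF dist, of 1 "length p - 2"] len by simp
          hence "length q = 1" by (simp add: p_def)
          hence p: "p = [u, s, w]" by (auto simp: p_def w_def length_Suc_conv)
          have sw: "E s w" "s \<noteq> w" "u \<noteq> s" "w \<noteq> v"
            using pw dist e by (auto simp: p is_path_def)
          \<comment> \<open>An edge between \<open>w\<close> and \<open>u\<close> would avoid
            \<open>s\<close>, against \<open>sepw\<close>. Hence \<open>[v, w, s]\<close> is an ear
            at \<open>u\<close>.\<close>
          have "\<not> E w u"
          proof
            assume "E w u"
            hence "reach E (W - {v, s}) w u"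
              using sw e us by (intro reach_edge) auto
            thus False using sepw[OF us(1)] e by blast
          qed
          hence nuw: "\<not> E u w" using E_sym by blast
          have "ear u [v, w, s]"
            using e sw us nuw E_sym[OF us(1)] E_sym[OF sw(1)] E_sym[OF e(2)] zW
            by (auto simp: ear_def is_path_def)
          from ear_separates[OF split_nbr[OF sp us(1)] this, of v]
          have "\<not> reach E (W - {u, w}) s v" using us E_sym by auto
          moreover have "reach E (W - {u, w}) s z"
            using to_b[of "W - {u, w}"] bs sw(2,3) by (auto simp: p)
          moreover have "reach E (W - {u, w}) z v"
            using z zn e E_sym[OF z] zW by (intro reach_edge) auto
          ultimately show False using reach_trans by metis
        qed
      next
        case False
        hence bq: "b \<in> set q" using b(2) bu by (auto simp: p_def)
        then obtain q1 q2 where q12: "q = q1 @ b # q2" by (meson split_list)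
        \<comment> \<open>From \<open>b\<close> the rest of \<open>q\<close> leads to
          \<open>w\<close> and avoids \<open>s\<close>.\<close>
        have "is_path E (W - {v}) (b # q2)"
          using is_path_appendD(2)[of E "W - {v}" "u # s # q1" "b # q2"] pw
          by (simp add: p_def q12)
        hence "is_path E (W - {v, s}) (b # q2)"
          using dist by (auto simp: is_path_def p_def q12)
        from path_imp_reach[OF this] have bw: "reach E (W - {v, s}) b w"
          by (simp add: w_def q12)
        have "reach E (W - {v, s}) b z"
          using to_b[of "W - {v, s}"] False by (auto simp: p_def)
        hence "reach E (W - {v, s}) w z" using reach_trans reach_sym[OF symp_E bw] by metis
        thus False using sepw[OF z zn(2)] by blast
      qed
    qed
  qed
  hence "{z. E v z} = {u, w}" using e by auto
  thus ?thesis using e(4) by blast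
qed

text \<open>A universal \<open>x\<close> would be a common neighbour of \<open>v\<close> and
  \<open>s\<close>. The ear of \<open>v\<close> starting with \<open>x\<close>, \<open>s\<close>
  then ends at a vertex adjacent to \<open>x\<close>, and this edge avoids \<open>v\<close> and
  \<open>s\<close>, against \<open>ear_separates\<close>.\<close>

lemma split_not_universal:
  assumes sp: "split_at v" and s: "s \<in> W" "s \<noteq> v" "\<not> E v s" and x: "x \<in> W"
  shows "\<exists>y\<in>W. y \<noteq> x \<and> \<not> E x y"
proof (rule ccontr)
  assume no: "\<not> ?thesis"
  have vW: "v \<in> W" using sp by (auto simp: split_at_def E_def)
  have "x \<noteq> v" using s no by blast
  have "x \<noteq> s" using s no vW E_sym[of s v] by metis
  have "E v x" "E x s" using no s vW E_sym \<open>x \<noteq> v\<close> \<open>x \<noteq> s\<close> by metis+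
  then obtain q where q: "q \<noteq> []" "ear v (x # s # q)" using ear_of_distance_two s by blast
  note e = earD[OF q(2)]
  have "reach E (W - {v, s}) (last q) x"
  proof (rule reach_edge)
    have "last q \<in> set q" using q by simp
    moreover have "s \<notin> set q" "v \<notin> set q" using q by (auto simp: ear_def is_path_def)
    ultimately show "last q \<in> W - {v, s}" using e(6) q(1) by auto
    show "E (last q) x" using no e E_sym q(1) by auto
    show "x \<in> W - {v, s}" using x \<open>x \<noteq> v\<close> \<open>x \<noteq> s\<close> by auto
  qed
  moreover have "length (x # s # q) \<ge> 3" using q(1) by (cases q) auto
  ultimately show False
    using ear_separates[OF sp q(2) _ \<open>E v x\<close>] e q(1) by auto
qed

text \<open>If the block is not complete, no vertex is adjacent to all others, so each has exactly
  two neighbours. A path between the two neighbours of \<open>v\<close>, closed through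
  \<open>v\<close>, is then closed under adjacency and covers \<open>W\<close>.\<close>

lemma split_complete_or_cycle:
  assumes sp: "split_at v0"
  shows "(\<forall>u\<in>W. \<forall>w\<in>W. u \<noteq> w \<longrightarrow> E u w) \<or>
    (\<exists>c. distinct c \<and> set c = W \<and> length c \<ge> 3 \<and>
       (\<forall>i<length c. \<forall>j<length c. E (c ! i) (c ! j) \<longleftrightarrow>
          i \<noteq> j \<and> (j = Suc i mod length c \<or> i = Suc j mod length c)))"
proof (cases "\<forall>u\<in>W. \<forall>w\<in>W. u \<noteq> w \<longrightarrow> E u w")
  case False
  then obtain v s where vs: "v \<in> W" "s \<in> W" "s \<noteq> v" "\<not> E v s" by blast
  have two: "\<exists>u w. u \<noteq> w \<and> {z. E x z} = {u, w}" if "x \<in> W" for x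
    using split_not_universal[OF split_all[OF sp vs(1)] vs(2-4) that]
      split_two_nbrs[OF split_all[OF sp that]] by blast
  obtain u w where uw: "u \<noteq> w" "{z. E v z} = {u, w}" using two[OF vs(1)] by blast
  hence vuw: "E v u" "E v w" by auto
  hence in_W: "u \<in> W - {v}" "w \<in> W - {v}" using E_irrefl by (auto simp: E_def)
  obtain p where p: "is_path E (W - {v}) p" "hd p = u" "last p = w"
    using reach_imp_path[OF conn_del[OF vs(1) in_W] in_W(1)] by blast
  define c where "c = v # p"
  define n where "n = length c"
  have "length p \<ge> 2" using p uw by (cases p rule: remdups_adj.cases) (auto simp: is_path_def)
  hence n3: "n \<ge> 3" by (simp add: n_def c_def)
  have dist: "distinct c" and cW: "set c \<subseteq> W" and succ: "successively E c"
    using p vs vuw by (auto simp: c_def is_path_def successively_Cons)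
  have next_E: "E (c ! i) (c ! (Suc i mod n))" if "i < n" for i
  proof (cases "Suc i = n")
    case True
    hence "c ! i = w" using p by (auto simp: c_def n_def is_path_def last_conv_nth nth_Cons')
    thus ?thesis using True E_sym[OF vuw(2)] by (simp add: c_def)
  next
    case False
    thus ?thesis using succ that by (simp add: successively_conv_nth n_def)
  qed
  \<comment> \<open>Cyclic predecessor; \<open>i = 0\<close> is split off because truncated
    subtraction would give 0.\<close>
  define prv where "prv i = (if i = 0 then n - 1 else i - 1)" for i
  have prv: "prv i < n" "Suc (prv i) mod n = i" if "i < n" for i
    using that n3 by (auto simp: prv_def)
  have iff: "E (c ! i) z \<longleftrightarrow> z = c ! (Suc i mod n) \<or> z = c ! prv i" if i: "i < n" for i z
  proof -
    have 1: "E (c ! i) (c ! (Suc i mod n))" "E (c ! i) (c ! prv i)"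
      using next_E[OF i] next_E[OF prv(1)[OF i]] prv(2)[OF i] E_sym by auto
    \<comment> \<open>The bound \<open>n \<ge> 3\<close> keeps successor and predecessor distinct,
      so they are the only two neighbours that \<open>two\<close> allows.\<close>
    have "Suc i mod n \<noteq> prv i" using i n3 by (cases "Suc i = n") (auto simp: prv_def)
    moreover have "Suc i mod n < n" using n3 by simp
    ultimately have 2: "c ! (Suc i mod n) \<noteq> c ! prv i"
      using nth_eq_iff_index_eq[OF dist] prv(1)[OF i] unfolding n_def by blast
    have "c ! i \<in> W" using cW i by (auto simp: n_def)
    then obtain u' w' where "{z. E (c ! i) z} = {u', w'}" using two by blast
    hence "E (c ! i) y \<longleftrightarrow> y = u' \<or> y = w'" for y by blast
    thus ?thesis using 1 2 by metis
  qed
  have "y \<in> set c" if "reach E W v y" for y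
    using that unfolding reach_def
  proof (induction rule: rtranclp_induct)
    case (step y z)
    then obtain i where "i < n" "y = c ! i" by (auto simp: in_set_conv_nth n_def)
    moreover have "Suc i mod n < n" using n3 by simp
    ultimately have "z = c ! (Suc i mod n) \<or> z = c ! prv i" "Suc i mod n < n" "prv i < n"
      using iff[of i z] step(2) prv(1)[of i] by auto
    thus ?case unfolding n_def by (metis nth_mem)
  qed (simp add: c_def)
  hence set: "set c = W" using cW conn[OF vs(1)] by blast
  have "E (c ! i) (c ! j) \<longleftrightarrow> i \<noteq> j \<and> (j = Suc i mod n \<or> i = Suc j mod n)"
    if ij: "i < n" "j < n" for i j
  proof -
    have "c ! j = c ! k \<longleftrightarrow> j = k" if "k < n" for k
      using dist ij that by (simp add: nth_eq_iff_index_eq n_def)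
    hence "E (c ! i) (c ! j) \<longleftrightarrow> j = Suc i mod n \<or> j = prv i"
      using iff[OF ij(1)] prv(1)[OF ij(1)] n3 by simp
    also have "j = prv i \<longleftrightarrow> i = Suc j mod n"
      using prv(2)[OF ij(1)] ij by (cases "Suc j = n") (auto simp: prv_def)
    finally have *: "E (c ! i) (c ! j) \<longleftrightarrow> j = Suc i mod n \<or> i = Suc j mod n" .
    show ?thesis using * E_irrefl[of "c ! i"] by auto
  qed
  hence "distinct c \<and> set c = W \<and> length c \<ge> 3 \<and>
       (\<forall>i<length c. \<forall>j<length c. E (c ! i) (c ! j) \<longleftrightarrow>
          i \<noteq> j \<and> (j = Suc i mod length c \<or> i = Suc j mod length c))"
    using dist set n3 unfolding n_def by blast
  thus ?thesis by blast
qed blast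

section \<open>Blocks without split vertices\<close>

text \<open>One placement \<open>\<sigma>\<close>, filled also at the hole, serves every hole at
  once: a colour in the common set at \<open>y\<close> is adjacent to the tokens at all neighbours,
  so the hole moves on while no token changes. The factor \<open>t\<close> is the size of the common
  set.\<close>

lemma nonsplit_representation:
  assumes ns: "\<And>v. \<not> split_at v" and v: "v \<in> W" "W \<noteq> {v}" and g: "good v \<tau>"
  shows "\<exists>t \<sigma>. t \<ge> 1 \<and> (\<forall>u\<in>W. good u \<sigma> \<and> \<sigma> u \<in> X u) \<and>
    (\<forall>u\<in>W. \<forall>w\<in>W. u \<noteq> w \<longrightarrow> \<mu> u w = t * a (\<sigma> u) (\<sigma> w))"
proof -
  have nbr: "\<exists>u. E x u" if x: "x \<in> W" for x
  proof -
    obtain y where "y \<in> W" "y \<noteq> x" using v x by blast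
    with conn[OF x this(1)] show ?thesis
      unfolding reach_def by (auto elim: converse_rtranclpE)
  qed
  obtain u0 where u0: "E v u0" using nbr v by blast
  obtain x where x: "x \<in> A v \<tau> u0" using A_nonempty[OF g u0] by blast
  define \<sigma> where "\<sigma> = \<tau>(v := x)"
  have "u0 \<noteq> v" "u0 \<in> W" using u0 E_irrefl by (auto simp: E_def)
  hence g0: "good u0 \<sigma>" using move[OF g v(1), of u0 x] x by (simp add: \<sigma>_def A_def)
  define full where "full y \<longleftrightarrow> good y \<sigma> \<and> (\<forall>w. E y w \<longrightarrow> \<sigma> y \<in> A y \<sigma> w)" for y
  have full_nbr: "full z" if gy: "good y \<sigma>" and yz: "E y z" and pos: "\<sigma> y \<in> X y" "a (\<sigma> y) (\<sigma> z) > 0" for y z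
  proof -
    have ne: "y \<noteq> z" "y \<in> W" "z \<in> W" using yz E_irrefl by (auto simp: E_def)
    \<comment> \<open>The move refills \<open>y\<close> with its present value, so the placement is
      unchanged.\<close>
    have "good z (\<sigma>(y := \<sigma> y))" using move[OF gy, of z "\<sigma> y"] ne pos by auto
    hence gz: "good z \<sigma>" by simp
    have "\<sigma> z \<in> X z" using good_in[OF gy] ne W_subset by blast
    hence "\<sigma> z \<in> A z \<sigma> y" using pos by (simp add: A_def a_sym)
    moreover have "A z \<sigma> w = A z \<sigma> y" if "E z w" for w
      using ns[of z] gz that E_sym[OF yz] unfolding split_at_def by blast
    ultimately show ?thesis using gz by (simp add: full_def)
  qed
  \<comment> \<open>The colour \<open>x\<close> was chosen only for its adjacency to the token at
    \<open>u0\<close>; approaching \<open>v\<close> from \<open>u0\<close> yields adjacency to the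
    tokens at all neighbours.\<close>
  have "full v"
  proof (rule full_nbr[OF g0 E_sym[OF u0]])
    show "\<sigma> u0 \<in> X u0" using good_in[OF g] \<open>u0 \<noteq> v\<close> \<open>u0 \<in> W\<close> W_subset by (auto simp: \<sigma>_def)
    show "a (\<sigma> u0) (\<sigma> v) > 0" using x \<open>u0 \<noteq> v\<close> by (simp add: \<sigma>_def A_def a_sym)
  qed
  have full: "full y" if "y \<in> W" for y
    using conn[OF v(1) that] unfolding reach_def
  proof (induction rule: rtranclp_induct)
    case (step y z)
    thus ?case using full_nbr[of y z] by (auto simp: full_def A_def)
  qed (fact \<open>full v\<close>)
  \<comment> \<open>All neighbours of \<open>y\<close> give the same set, so the choice by
    \<open>SOME\<close> does not matter.\<close>
  define t where "t y = card (A y \<sigma> (SOME w. E y w))" for y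
  have t: "t y = card (A y \<sigma> w)" if "E y w" for y w
  proof -
    have "E y (SOME w. E y w)" using that by (rule someI)
    moreover have "good y \<sigma>" using full[of y] that by (auto simp: full_def E_def)
    ultimately show ?thesis using ns[of y] that unfolding split_at_def t_def by metis
  qed
  have \<mu>_t: "\<mu> y w = t y * a (\<sigma> y) (\<sigma> w)" if yw: "E y w" for y w
  proof -
    have "y \<in> W" "w \<in> W" "w \<noteq> y" using yw E_irrefl by (auto simp: E_def)
    thus ?thesis using card_A[of y \<sigma> w "\<sigma> y"] full[of y] yw t[OF yw] by (auto simp: full_def)
  qed
  \<comment> \<open>Both \<open>\<mu>\<close> and \<open>a\<close> are symmetric and nonzero on an
    edge, so the factors at its two ends agree.\<close>
  have t_const: "t y = t v" if "y \<in> W" for y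
    using conn[OF v(1) that] unfolding reach_def
  proof (induction rule: rtranclp_induct)
    case (step y z)
    hence yz: "E y z" "E z y" using E_sym by auto
    have "\<mu> y z > 0" using yz by (simp add: E_def)
    thus ?case using \<mu>_t[OF yz(1)] \<mu>_t[OF yz(2)] \<mu>_sym[of y z] a_sym[of "\<sigma> y"] step(3) by auto
  qed simp
  have in_X: "\<sigma> y \<in> X y" if "y \<in> W" for y
    using full[OF that] nbr[OF that] by (auto simp: full_def A_def)
  have "\<mu> y w = t v * a (\<sigma> y) (\<sigma> w)" if yw: "y \<in> W" "w \<in> W" "y \<noteq> w" for y w
  proof (cases "E y w")
    case True thus ?thesis using \<mu>_t t_const yw by simp
  next
    case False
    have "a (\<sigma> y) (\<sigma> w) = 0"
      using non_nbr_zero[of y \<sigma> w "\<sigma> y"] full[of y] yw False in_X by (auto simp: full_def)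
    thus ?thesis using False yw by (simp add: E_def)
  qed
  moreover have "t v \<ge> 1" using \<mu>_t[OF u0] u0 by (cases "t v") (auto simp: E_def)
  ultimately show ?thesis using full in_X by (intro exI[of _ "t v"] exI[of _ \<sigma>]) (auto simp: full_def)
qed

end

section \<open>Multigraphs\<close>

lemma finite_verts: "finite (verts G)"
  by transfer auto

lemma mult_sym: "mult G u v = mult G v u"
  by transfer (auto simp: split_beta)

lemma mult_irrefl: "mult G v v = 0"
  by transfer (auto simp: split_beta)

lemma mult_in_verts: "mult G u v > 0 \<Longrightarrow> u \<in> verts G \<and> v \<in> verts G"
proof -
  have *: "mult G u v > 0 \<Longrightarrow> u \<in> verts G" for u v
    by transfer (auto simp: split_beta)
  show "mult G u v > 0 \<Longrightarrow> u \<in> verts G \<and> v \<in> verts G"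
    using * mult_sym[of G u v] by metis
qed

lemma verts_induced: "verts (induced G S) = verts G \<inter> S"
  by transfer (auto simp: split_beta)

lemma mult_induced: "mult (induced G S) u v = (if u \<in> S \<and> v \<in> S then mult G u v else 0)"
  by transfer (auto simp: split_beta)

lemma verts_scale: "verts (scale t G) = verts G"
  by transfer (auto simp: split_beta)

lemma mult_scale: "mult (scale t G) u v = t * mult G u v"
  by transfer (auto simp: split_beta)

lemma verts_complete_graph: "verts (complete_graph n) = {..<n}"
  by transfer simp

lemma mult_complete_graph:
  "mult (complete_graph n) u v = (if u < n \<and> v < n \<and> u \<noteq> v then 1 else 0)"
  by transfer simp

lemma verts_cycle_graph: "verts (cycle_graph n) = {..<n}"
  by transfer simp

lemma mult_cycle_graph:
  "mult (cycle_graph n) u v =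
    (if u < n \<and> v < n \<and> u \<noteq> v \<and> (v = Suc u mod n \<or> u = Suc v mod n) then 1 else 0)"
  by transfer simp

lemma mgraph_eqI:
  assumes "verts G = verts G'" "\<And>u v. mult G u v = mult G' u v"
  shows "G = G'"
  using assms by transfer (auto simp: split_beta prod_eq_iff fun_eq_iff)

text \<open>The truncation outside \<open>V\<close> is the normalisation built into the
  type.\<close>

lemma ex_mgraph:
  fixes m :: "'a \<Rightarrow> 'a \<Rightarrow> nat"
  assumes "finite V" "\<And>u v. m u v = m v u" "\<And>v. m v v = 0"
  shows "\<exists>G. verts G = V \<and> (\<forall>u v. mult G u v = (if u \<in> V \<and> v \<in> V then m u v else 0))"
proof -
  let ?p = "(V, \<lambda>u v. if u \<in> V \<and> v \<in> V then m u v else 0)"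
  have "?p \<in> {(V :: 'a set, m :: 'a \<Rightarrow> 'a \<Rightarrow> nat). finite V \<and> (\<forall>u v. m u v = m v u) \<and>
    (\<forall>v. m v v = 0) \<and> (\<forall>u v. m u v \<noteq> 0 \<longrightarrow> u \<in> V)}"
    using assms by auto
  hence "Rep_mgraph (Abs_mgraph ?p) = ?p" by (rule Abs_mgraph_inverse)
  thus ?thesis by (intro exI[of _ "Abs_mgraph ?p"]) (simp add: verts.rep_eq mult.rep_eq)
qed

section \<open>Isomorphism and membership in a property\<close>

lemma iso_sym:
  assumes "iso G G'" shows "iso G' G"
proof -
  obtain f where f: "bij_betw f (verts G) (verts G')"
    "\<forall>u\<in>verts G. \<forall>v\<in>verts G. mult G' (f u) (f v) = mult G u v"
    using assms by (auto simp: iso_def)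
  let ?g = "the_inv_into (verts G) f"
  have g: "?g y \<in> verts G" "f (?g y) = y" if "y \<in> verts G'" for y
    using f(1) that by (auto simp: bij_betw_def the_inv_into_into f_the_inv_into_f)
  show ?thesis unfolding iso_def
    using bij_betw_the_inv_into[OF f(1)] f(2) g by (intro exI[of _ ?g]) metis
qed

lemma iso_trans:
  assumes "iso G G'" "iso G' G''" shows "iso G G''"
proof -
  obtain f g where f: "bij_betw f (verts G) (verts G')"
    "\<forall>u\<in>verts G. \<forall>v\<in>verts G. mult G' (f u) (f v) = mult G u v"
    and g: "bij_betw g (verts G') (verts G'')"
    "\<forall>u\<in>verts G'. \<forall>v\<in>verts G'. mult G'' (g u) (g v) = mult G' u v"
    using assms by (auto simp: iso_def)
  have "f u \<in> verts G'" if "u \<in> verts G" for u using f(1) that by (auto simp: bij_betw_def)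
  thus ?thesis unfolding iso_def
    using bij_betw_trans[OF f(1) g(1)] f(2) g(2) by (intro exI[of _ "g \<circ> f"]) auto
qed

lemma iso_refl: "iso G G"
  unfolding iso_def by (intro exI[of _ id]) auto

lemma iso_induced:
  assumes "bij_betw f (verts G) (verts G')"
    "\<forall>u\<in>verts G. \<forall>v\<in>verts G. mult G' (f u) (f v) = mult G u v"
  shows "iso (induced G S) (induced G' (f ` (verts G \<inter> S)))"
proof -
  have "bij_betw f (verts G \<inter> S) (f ` (verts G \<inter> S))"
    using assms(1) by (auto simp: bij_betw_def intro: inj_on_subset)
  moreover have "verts G' \<inter> f ` (verts G \<inter> S) = f ` (verts G \<inter> S)"
    using assms(1) by (auto simp: bij_betw_def)
  ultimately show ?thesis
    using assms(2) unfolding iso_def by (intro exI[of _ f]) (auto simp: verts_induced mult_induced)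
qed

lemma induced_verts: "induced G (verts G) = G"
proof (rule mgraph_eqI)
  fix u v
  show "mult (induced G (verts G)) u v = mult G u v"
    using mult_in_verts[of G u v] by (auto simp: mult_induced)
qed (simp add: verts_induced)

lemma induced_induced: "induced (induced G S) S' = induced G (S \<inter> S')"
  by (rule mgraph_eqI) (auto simp: verts_induced mult_induced)

lemma has_prop_iso: "has_prop P G \<Longrightarrow> iso G G' \<Longrightarrow> has_prop P G'"
  unfolding has_prop_def using iso_sym iso_trans by blast

lemma has_prop_nat:
  assumes "graph_property P" shows "has_prop P G \<longleftrightarrow> G \<in> P"
  using assms iso_refl iso_sym unfolding has_prop_def graph_property_def by blast

lemma has_prop_induced:
  assumes "hereditary P" "has_prop P G" shows "has_prop P (induced G S)"
proof -
  obtain G' f where G': "G' \<in> P" and f: "bij_betw f (verts G) (verts G')"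
    "\<forall>u\<in>verts G. \<forall>v\<in>verts G. mult G' (f u) (f v) = mult G u v"
    using assms(2) by (auto simp: has_prop_def iso_def)
  have "f ` (verts G \<inter> S) \<subseteq> verts G'" using f(1) by (auto simp: bij_betw_def)
  hence "induced G' (f ` (verts G \<inter> S)) \<in> P" using assms(1) G' by (auto simp: hereditary_def)
  thus ?thesis using iso_induced[OF f] by (auto simp: has_prop_def)
qed

lemma has_prop_subset:
  assumes "hereditary P" "has_prop P (induced G S)" "S' \<subseteq> S"
  shows "has_prop P (induced G S')"
  using has_prop_induced[OF assms(1,2), of S'] assms(3) by (simp add: induced_induced Int_absorb1)

lemma has_prop_empty:
  assumes "hereditary P" "nontrivial P"
  shows "has_prop P (induced G {})"
proof -
  obtain G' where "G' \<in> P" using assms(2) by (auto simp: nontrivial_def)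
  hence "induced G' {} \<in> P" using assms(1) by (auto simp: hereditary_def)
  moreover have "iso (induced G {}) (induced G' {})" by (simp add: iso_def verts_induced bij_betw_def)
  ultimately show ?thesis by (auto simp: has_prop_def)
qed

lemma ex_nat_copy: "\<exists>N :: nat mgraph. iso G N"
proof -
  obtain h where h: "bij_betw h {0..<card (verts G)} (verts G)"
    using ex_bij_betw_nat_finite[OF finite_verts] by blast
  obtain N where "verts N = {0..<card (verts G)}"
    "\<forall>u v. mult N u v = (if u \<in> {0..<card (verts G)} \<and> v \<in> {0..<card (verts G)} then mult G (h u) (h v) else 0)"
    using ex_mgraph[of "{0..<card (verts G)}" "\<lambda>u v. mult G (h u) (h v)",
        OF finite_atLeastLessThan mult_sym mult_irrefl] by blast
  hence "iso N G" using h unfolding iso_def by (intro exI[of _ h]) auto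
  thus ?thesis using iso_sym by blast
qed

text \<open>Edges at \<open>v\<close> correspond to pairs of the other end and the index.\<close>

lemma degree_eq_sum: "degree G v = (\<Sum>u\<in>verts G. mult G v u)"
proof -
  have "bij_betw (\<lambda>(u, i). ({v, u}, i)) (SIGMA u:verts G. {..<mult G v u}) {e \<in> edges G. v \<in> fst e}"
  proof (rule bij_betw_imageI)
    show "inj_on (\<lambda>(u, i). ({v, u}, i)) (SIGMA u:verts G. {..<mult G v u})"
      by (auto simp: inj_on_def doubleton_eq_iff)
    show "(\<lambda>(u, i). ({v, u}, i)) ` (SIGMA u:verts G. {..<mult G v u}) = {e \<in> edges G. v \<in> fst e}"
    proof (intro equalityI subsetI)
      fix e assume "e \<in> {e \<in> edges G. v \<in> fst e}"
      then obtain x y i where e: "e = ({x, y}, i)" "i < mult G x y" "v = x \<or> v = y"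
        by (auto simp: edges_def)
      then obtain u where "e = ({v, u}, i)" "i < mult G v u"
        using mult_sym[of G x y] by (metis insert_commute)
      thus "e \<in> (\<lambda>(u, i). ({v, u}, i)) ` (SIGMA u:verts G. {..<mult G v u})"
        using mult_in_verts[of G v u] by (auto intro!: image_eqI[of _ _ "(u, i)"])
    qed (auto simp: edges_def)
  qed
  hence "degree G v = card (SIGMA u:verts G. {..<mult G v u})"
    by (simp add: degree_def bij_betw_same_card)
  also have "\<dots> = (\<Sum>u\<in>verts G. mult G v u)" using finite_verts[of G] by (simp add: card_SigmaI)
  finally show ?thesis .
qed

text \<open>A smallest vertex set \<open>S\<close> inducing a graph outside \<open>P\<close> is
  critical, since deleting a vertex gives a smaller set. Its degrees are then at least
  \<open>prop_d P\<close>.\<close>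

lemma ex_critical_subgraph:
  assumes P: "graph_property P" "hereditary P" and np: "\<not> has_prop P K"
  shows "\<exists>S\<subseteq>verts K. \<not> has_prop P (induced K S) \<and> has_prop (CR P) (induced K S) \<and>
    (\<forall>v\<in>S. prop_d P \<le> (\<Sum>u\<in>S. mult K v u))"
proof -
  define Q where "Q S \<longleftrightarrow> S \<subseteq> verts K \<and> \<not> has_prop P (induced K S)" for S
  have "Q (verts K)"
    using np by (simp add: Q_def induced_verts)
  then obtain S where S: "Q S" "\<And>S'. Q S' \<Longrightarrow> card S \<le> card S'"
    using ex_has_least_nat[of Q _ card] by metis
  have SK: "S \<subseteq> verts K" and fin: "finite S"
    using S(1) finite_verts finite_subset by (auto simp: Q_def)
  have del: "has_prop P (induced K (S - {v}))" if "v \<in> S" for v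
  proof (rule ccontr)
    assume "\<not> ?thesis"
    hence "Q (S - {v})" using SK by (auto simp: Q_def)
    hence "card S \<le> card (S - {v})" by (rule S(2))
    thus False using card_Diff1_less[OF fin that] by simp
  qed
  \<comment> \<open>The class \<open>CR P\<close> consists of graphs on natural numbers, so
    criticality is checked on a copy \<open>N\<close>.\<close>
  obtain N :: "nat mgraph" where "iso (induced K S) N" using ex_nat_copy by blast
  then obtain f where f: "bij_betw f S (verts N)"
    "\<forall>u\<in>S. \<forall>v\<in>S. mult N (f u) (f v) = mult K u v"
    using SK by (auto simp: iso_def verts_induced mult_induced Int_absorb1 Int_absorb2)
  have isoN: "iso (induced K S) N" by fact
  have "N \<in> CR P" unfolding CR_def
  proof (intro CollectI conjI ballI)
    show "N \<notin> P"
      using isoN S(1) by (auto simp: Q_def has_prop_def)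
    fix y assume "y \<in> verts N"
    then obtain v where v: "v \<in> S" "y = f v" using f(1) by (auto simp: bij_betw_def)
    have "iso (induced (induced K S) (S - {v})) (induced N (f ` (verts (induced K S) \<inter> (S - {v}))))"
      using f SK by (intro iso_induced) (auto simp: verts_induced mult_induced Int_absorb1)
    moreover have "verts (induced K S) \<inter> (S - {v}) = S - {v}" using SK by (auto simp: verts_induced)
    moreover have "f ` (S - {v}) = verts N - {y}"
      using f(1) v by (auto simp: bij_betw_def inj_on_def)
    moreover have "S \<inter> (S - {v}) = S - {v}" by blast
    ultimately have "iso (induced K (S - {v})) (delete_vertex N y)"
      by (simp add: induced_induced delete_vertex_def)
    thus "delete_vertex N y \<in> P"
      using has_prop_iso[OF del[OF v(1)]] has_prop_nat[OF P(1)] by blast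
  qed
  hence "has_prop (CR P) (induced K S)" using isoN by (auto simp: has_prop_def)
  moreover have "prop_d P \<le> (\<Sum>u\<in>S. mult K v u)" if v: "v \<in> S" for v
  proof -
    have "prop_d P \<le> min_degree N"
      unfolding prop_d_def using \<open>N \<in> CR P\<close> by (intro Least_le) blast
    also have "\<dots> \<le> degree N (f v)"
      unfolding min_degree_def using f(1) v finite_verts by (intro Min_le) (auto simp: bij_betw_def)
    also have "\<dots> = (\<Sum>u\<in>S. mult N (f v) (f u))"
      unfolding degree_eq_sum by (rule sum.reindex_bij_betw[OF f(1), symmetric])
    also have "\<dots> = (\<Sum>u\<in>S. mult K v u)" using f(2) v by (intro sum.cong) auto
    finally show ?thesis .
  qed
  ultimately show ?thesis using S(1) by (auto simp: Q_def)
qed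

text \<open>Each of the \<open>mult G u v\<close> matchings contains at most one edge at
  \<open>y\<close>.\<close>

lemma cover_col_le:
  assumes cover: "is_cover G X H" and uv: "u \<in> verts G" "v \<in> verts G" "u \<noteq> v" and y: "y \<in> X u"
  shows "(\<Sum>x\<in>X v. mult H x y) \<le> mult G u v"
proof -
  obtain M where M: "\<forall>i < mult G u v. matching H (M i)"
      "edges_between H (X u) (X v) = (\<Union>i < mult G u v. M i)"
    using cover uv unfolding is_cover_def by blast
  have "X v \<subseteq> verts H" using cover uv by (auto simp: is_cover_def)
  hence fin: "finite (X v)" using finite_verts finite_subset by blast
  have "X u \<inter> X v = {}" using cover uv by (auto simp: is_cover_def disjoint_family_on_def)
  hence yv: "y \<notin> X v" using y by blast
  define D where "D i = {e \<in> M i. y \<in> fst e}" for i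
  have D: "finite (D i) \<and> card (D i) \<le> 1" if "i < mult G u v" for i
  proof -
    have eq: "e = e'" if "e \<in> D i" "e' \<in> D i" for e e'
      using M(1) \<open>i < mult G u v\<close> that unfolding D_def matching_def by blast
    show ?thesis
    proof (cases "D i = {}")
      case False
      then obtain e where "D i = {e}" using eq by blast
      thus ?thesis by simp
    qed simp
  qed
  have "(\<Sum>x\<in>X v. mult H x y) = card (SIGMA x:X v. {..<mult H x y})" using fin by simp
  also have "\<dots> \<le> card (\<Union>i < mult G u v. D i)"
  proof (rule card_inj_on_le)
    show "inj_on (\<lambda>(x, i). ({y, x}, i)) (SIGMA x:X v. {..<mult H x y})"
      using yv by (auto simp: inj_on_def doubleton_eq_iff)
    show "(\<lambda>(x, i). ({y, x}, i)) ` (SIGMA x:X v. {..<mult H x y}) \<subseteq> (\<Union>i < mult G u v. D i)"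
    proof clarify
      fix x i assume x: "x \<in> X v" "i < mult H x y"
      have "({y, x}, i) \<in> edges_between H (X u) (X v)"
        using x y mult_sym[of H x y] unfolding edges_between_def edges_def by fastforce
      thus "({y, x}, i) \<in> (\<Union>i < mult G u v. D i)" unfolding M(2) D_def by auto
    qed
    show "finite (\<Union>i < mult G u v. D i)" using D by blast
  qed
  also have "\<dots> \<le> (\<Sum>i < mult G u v. card (D i))" by (rule card_UN_le) simp
  also have "\<dots> \<le> (\<Sum>i < mult G u v. 1)" using D by (intro sum_mono) auto
  finally show ?thesis by simp
qed

section \<open>Components, separating vertices and blocks\<close>

lemma connected_graph_mono:
  assumes "connected_graph C" "verts D = verts C" "\<And>u v. mult C u v \<le> mult D u v"
  shows "connected_graph D"
proof -
  have "(\<lambda>x y. mult C x y > 0) \<le> (\<lambda>x y. mult D x y > 0)"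
    using assms(3) by (auto intro: less_le_trans)
  from rtranclp_mono[OF this] assms(1,2) show ?thesis unfolding connected_graph_def by blast
qed

lemma components_connected:
  assumes "connected_graph G" shows "components G = {G}"
  using assms unfolding components_def subgraph_def
  by (auto intro!: mgraph_eqI simp: order_antisym)

text \<open>By maximality a component is induced by its vertex set. The resulting finiteness matters
  because \<open>card\<close> of an infinite set is 0, which would spoil the count in
  \<open>separating_vertex\<close>.\<close>

lemma components_subset: "components G \<subseteq> induced G ` Pow (verts G)"
proof
  fix C assume C: "C \<in> components G"
  let ?D = "induced G (verts C)"
  have sub: "verts C \<subseteq> verts G" "\<And>u v. mult C u v \<le> mult G u v"
    and conn: "connected_graph C" using C by (auto simp: components_def subgraph_def)
  have v: "verts ?D = verts C" using sub by (auto simp: verts_induced)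
  have m: "mult C u v \<le> mult ?D u v" for u v
    using sub(2)[of u v] mult_in_verts[of C u v] by (auto simp: mult_induced)
  have "connected_graph ?D" by (rule connected_graph_mono[OF conn v m])
  moreover have "subgraph ?D G" "subgraph C ?D" using sub v m
    by (auto simp: subgraph_def mult_induced)
  ultimately have "?D = C" using C by (auto simp: components_def)
  thus "C \<in> induced G ` Pow (verts G)" using sub by (metis PowI image_eqI)
qed

lemma finite_components: "finite (components G)"
  using components_subset finite_verts by (meson finite_Pow_iff finite_imageI finite_subset)

lemma component_of_vertex:
  assumes a: "a \<in> verts G"
  defines "R \<equiv> {b. (\<lambda>x y. mult G x y > 0)\<^sup>*\<^sup>* a b}"
  shows "induced G R \<in> components G"
proof -
  let ?C = "induced G R"
  let ?e = "\<lambda>x y. mult G x y > 0"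
  have RG: "b \<in> verts G" if "?e\<^sup>*\<^sup>* a b" for b
    using that by (induction rule: rtranclp_induct) (use a mult_in_verts[of G] in blast)+
  have vC: "verts ?C = R" using RG by (auto simp: verts_induced R_def)
  have ab: "(\<lambda>x y. mult ?C x y > 0)\<^sup>*\<^sup>* a b" if "?e\<^sup>*\<^sup>* a b" for b
    using that
  proof (induction rule: rtranclp_induct)
    case (step y z)
    have "y \<in> R" "z \<in> R" using step(1,2) by (auto simp: R_def intro: rtranclp.rtrancl_into_rtrancl)
    hence "mult ?C y z > 0" using step(2) by (simp add: mult_induced)
    thus ?case using step(3) by (rule rtranclp.rtrancl_into_rtrancl[rotated])
  qed simp
  have sym: "symp (\<lambda>x y. mult ?C x y > 0)" using mult_sym[of ?C] by (auto simp: symp_def)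
  have "connected_graph ?C"
    unfolding connected_graph_def vC
  proof (intro conjI ballI)
    show "R \<noteq> {}" by (auto simp: R_def)
    fix x y assume "x \<in> R" "y \<in> R"
    hence "(\<lambda>x y. mult ?C x y > 0)\<^sup>*\<^sup>* a x" "(\<lambda>x y. mult ?C x y > 0)\<^sup>*\<^sup>* a y"
      using ab by (auto simp: R_def)
    thus "(\<lambda>x y. mult ?C x y > 0)\<^sup>*\<^sup>* x y"
      using sympD[OF symp_rtranclp[OF sym]] rtranclp_trans by metis
  qed
  moreover have "subgraph ?C G" by (auto simp: subgraph_def verts_induced mult_induced)
  moreover have "D = ?C" if D: "subgraph D G" "connected_graph D" "subgraph ?C D" for D
  proof (rule mgraph_eqI)
    have aD: "a \<in> verts D" using D(3) vC by (auto simp: subgraph_def R_def)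
    have "(\<lambda>x y. mult D x y > 0) \<le> ?e" using D(1) by (auto simp: subgraph_def intro: less_le_trans)
    from rtranclp_mono[OF this] have "verts D \<subseteq> R"
      using D(2) aD unfolding connected_graph_def R_def by blast
    thus v: "verts D = verts ?C" using D(3) vC by (auto simp: subgraph_def)
    fix x y
    show "mult D x y = mult ?C x y"
    proof (cases "x \<in> R \<and> y \<in> R")
      case True
      hence "mult ?C x y = mult G x y" by (simp add: mult_induced)
      thus ?thesis using D(1,3) unfolding subgraph_def by (metis order_antisym)
    next
      case False
      hence "mult D x y = 0" using mult_in_verts[of D x y] v vC by auto
      thus ?thesis using False by (auto simp: mult_induced)
    qed
  qed
  ultimately show ?thesis unfolding components_def by blast
qed

lemma connected_if_one_component:
  assumes "card (components G) < 2" "verts G \<noteq> {}"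
  shows "connected_graph G"
  unfolding connected_graph_def
proof (intro conjI ballI)
  fix x y assume xy: "x \<in> verts G" "y \<in> verts G"
  let ?R = "\<lambda>a. {b. (\<lambda>x y. mult G x y > 0)\<^sup>*\<^sup>* a b}"
  have "induced G (?R x) = induced G (?R y)"
  proof (rule ccontr)
    assume "\<not> ?thesis"
    hence "card {induced G (?R x), induced G (?R y)} = 2" by simp
    moreover have "{induced G (?R x), induced G (?R y)} \<subseteq> components G"
      using component_of_vertex[OF xy(1)] component_of_vertex[OF xy(2)] by simp
    ultimately show False using assms(1) card_mono[OF finite_components] by (metis linorder_not_less)
  qed
  hence "verts G \<inter> ?R x = verts G \<inter> ?R y" by (metis verts_induced)
  thus "(\<lambda>x y. mult G x y > 0)\<^sup>*\<^sup>* x y" using xy by blast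
qed (fact assms)

text \<open>The case \<open>verts G = {v}\<close> is separate because deletion then leaves the empty
  graph, which has no components but is not connected either.\<close>

lemma nonseparable_iff:
  "nonseparable G \<longleftrightarrow> connected_graph G \<and>
    (\<forall>v\<in>verts G. verts G = {v} \<or> connected_graph (delete_vertex G v))"
proof (cases "connected_graph G")
  case True
  have empty: "components D = {}" if "verts D = {}" for D :: "'a mgraph"
    using that by (auto simp: components_def connected_graph_def subgraph_def)
  have "card (components (delete_vertex G v)) \<ge> 2 \<longleftrightarrow>
      \<not> (verts G = {v} \<or> connected_graph (delete_vertex G v))" if v: "v \<in> verts G" for v
  proof -
    have "verts (delete_vertex G v) = verts G - {v}"
      by (auto simp: delete_vertex_def verts_induced)
    moreover have "verts G - {v} = {} \<longleftrightarrow> verts G = {v}" using v by blast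
    ultimately show ?thesis
      using connected_if_one_component[of "delete_vertex G v"]
        components_connected[of "delete_vertex G v"] empty[of "delete_vertex G v"] by fastforce
  qed
  thus ?thesis using True components_connected[OF True]
    by (auto simp: nonseparable_def separating_vertex_def)
qed (auto simp: nonseparable_def)

text \<open>Adding all edges of \<open>G\<close> on \<open>verts B\<close> preserves connectedness,
  also after a vertex deletion, so maximality of the block forces equality.\<close>

lemma block_induced:
  assumes "is_block B G"
  shows "B = induced G (verts B)"
proof -
  let ?D = "induced G (verts B)"
  have B: "verts B \<subseteq> verts G" "\<And>u v. mult B u v \<le> mult G u v" "nonseparable B"
    and max: "\<And>B'. subgraph B' G \<Longrightarrow> nonseparable B' \<Longrightarrow> subgraph B B' \<Longrightarrow> B' = B"
    using assms by (auto simp: is_block_def subgraph_def)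
  have v: "verts ?D = verts B" using B(1) by (auto simp: verts_induced)
  have m: "mult B u v \<le> mult ?D u v" for u v
    using B(2)[of u v] mult_in_verts[of B u v] by (auto simp: mult_induced)
  have "nonseparable ?D" unfolding nonseparable_iff
  proof (intro conjI ballI)
    show "connected_graph ?D"
      using connected_graph_mono[OF _ v m] B(3) by (simp add: nonseparable_iff)
    fix x assume x: "x \<in> verts ?D"
    have "connected_graph (delete_vertex ?D x)" if "connected_graph (delete_vertex B x)"
      using that B(2) v
      by (elim connected_graph_mono) (auto simp: delete_vertex_def verts_induced mult_induced)
    thus "verts ?D = {x} \<or> connected_graph (delete_vertex ?D x)"
      using B(3) x v by (auto simp: nonseparable_iff)
  qed
  moreover have "subgraph ?D G" by (auto simp: subgraph_def verts_induced mult_induced)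
  moreover have "subgraph B ?D" using v m by (auto simp: subgraph_def)
  ultimately show ?thesis using max by metis
qed

section \<open>Critical covers\<close>

text \<open>A choice function stands for the partial transversal, so that moving the hole is a
  function update.\<close>

definition good_state ::
  "nat mgraph set \<Rightarrow> 'a mgraph \<Rightarrow> ('a \<Rightarrow> 'b set) \<Rightarrow> 'b mgraph \<Rightarrow> 'a \<Rightarrow> ('a \<Rightarrow> 'b) \<Rightarrow> bool" where
  "good_state P G X H v \<tau> \<longleftrightarrow> v \<in> verts G \<and> (\<forall>w \<in> verts G - {v}. \<tau> w \<in> X w) \<and>
     has_prop P (induced H (\<tau> ` (verts G - {v})))"

lemma transversal_image:
  assumes "is_cover G X H" "\<forall>w\<in>verts G. \<sigma> w \<in> X w"
  shows "transversal G X H (\<sigma> ` verts G)"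
  unfolding transversal_def
proof (intro conjI ballI)
  show "\<sigma> ` verts G \<subseteq> verts H" using assms by (auto simp: is_cover_def)
  fix w assume w: "w \<in> verts G"
  have "\<sigma> ` verts G \<inter> X w = {\<sigma> w}"
  proof (intro equalityI subsetI)
    fix y assume "y \<in> \<sigma> ` verts G \<inter> X w"
    then obtain u where u: "u \<in> verts G" "y = \<sigma> u" "\<sigma> u \<in> X w" by blast
    hence "X u \<inter> X w \<noteq> {}" using assms(2) by blast
    hence "u = w" using assms(1) u(1) w unfolding is_cover_def disjoint_family_on_def by blast
    thus "y \<in> {\<sigma> w}" using u by simp
  qed (use w assms(2) in auto)
  thus "card (\<sigma> ` verts G \<inter> X w) = 1" by simp
qed

lemma ex_good_state:
  assumes "critical_cover P G X H" "v \<in> verts G"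
  shows "\<exists>\<tau>. good_state P G X H v \<tau>"
proof -
  obtain T where T: "partial_transversal G X H T" "transversal_dom G X T = verts G - {v}"
      "has_prop P (induced H T)"
    using assms by (auto simp: critical_cover_def)
  have cover: "is_cover G X H" using assms(1) by (simp add: critical_cover_def)
  define \<tau> where "\<tau> w = (SOME y. y \<in> T \<inter> X w)" for w
  have \<tau>: "\<tau> w \<in> T \<inter> X w" if "w \<in> verts G - {v}" for w
  proof -
    have "w \<in> transversal_dom G X T" using that T(2) by simp
    hence "\<exists>y. y \<in> T \<inter> X w" by (auto simp: transversal_dom_def)
    thus ?thesis unfolding \<tau>_def by (rule someI_ex)
  qed
  have "\<tau> ` (verts G - {v}) = T"
  proof (intro equalityI subsetI)
    fix y assume y: "y \<in> T"
    then obtain w where w: "w \<in> verts G" "y \<in> X w"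
      using T(1) cover by (auto simp: partial_transversal_def is_cover_def)
    hence "w \<in> transversal_dom G X T" using y by (auto simp: transversal_dom_def)
    hence w': "w \<in> verts G - {v}" using T(2) by simp
    have "T \<subseteq> verts H" using T(1) by (simp add: partial_transversal_def)
    hence "finite (T \<inter> X w)" using finite_verts finite_subset by blast
    moreover have "card (T \<inter> X w) \<le> 1" using T(1) w by (simp add: partial_transversal_def)
    ultimately have "y = \<tau> w" using \<tau>[OF w'] y w by (auto simp: card_le_Suc0_iff_eq)
    thus "y \<in> \<tau> ` (verts G - {v})" using w' by blast
  qed (use \<tau> in blast)
  thus ?thesis using T(3) \<tau> assms(2) unfolding good_state_def by (intro exI[of _ \<tau>]) auto
qed

text \<open>A critical subgraph inside the enlarged set must contain \<open>x\<close>, since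
  everything else lies in \<open>T\<close>; there \<open>x\<close> has degree at least
  \<open>prop_d P\<close>.\<close>

lemma row_lower_bound:
  assumes P: "graph_property P" "hereditary P" and T: "has_prop P (induced H T)"
    and U: "finite U" "\<tau> ` U \<subseteq> T" and np: "\<not> has_prop P (induced H (insert x (\<tau> ` U)))"
  shows "prop_d P \<le> (\<Sum>u\<in>U. mult H x (\<tau> u))"
proof -
  let ?K = "induced H (insert x (\<tau> ` U))"
  obtain S where S: "S \<subseteq> verts ?K" "\<not> has_prop P (induced ?K S)"
    "\<forall>v\<in>S. prop_d P \<le> (\<Sum>u\<in>S. mult ?K v u)"
    using ex_critical_subgraph[OF P np] by blast
  have sub: "S \<subseteq> insert x (\<tau> ` U)" using S(1) by (auto simp: verts_induced)
  have ind: "induced ?K S = induced H S" using sub by (simp add: induced_induced Int_absorb1)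
  have "x \<in> S"
  proof (rule ccontr)
    assume "x \<notin> S"
    hence "S \<subseteq> T" using sub U by blast
    thus False using has_prop_subset[OF P(2) T] S(2) ind by simp
  qed
  hence "prop_d P \<le> (\<Sum>u\<in>S. mult ?K x u)" using S(3) by blast
  also have "\<dots> \<le> (\<Sum>u\<in>S. mult H x u)" by (intro sum_mono) (auto simp: mult_induced)
  also have "\<dots> = (\<Sum>u\<in>S - {x}. mult H x u)"
    using finite_subset[OF sub] U(1) mult_irrefl[of H x]
    by (intro sum.mono_neutral_right) auto
  also have "\<dots> \<le> (\<Sum>u\<in>\<tau> ` U. mult H x u)" using sub U(1) by (intro sum_mono2) auto
  \<comment> \<open>Distinct vertices of \<open>U\<close> may share a token here, so only an
    inequality is claimed.\<close>
  also have "\<dots> \<le> (\<Sum>u\<in>U. mult H x (\<tau> u))" using sum_image_le[OF U(1), of "mult H x" \<tau>] by (simp add: comp_def)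
  finally show ?thesis .
qed

text \<open>Double counting of the edges between \<open>X v\<close> and the tokens. Rows are at
  least \<open>prop_d P\<close> because no transversal has property \<open>P\<close>, columns are at
  most \<open>mult G v u\<close> by the cover condition, and for a low vertex the two totals agree,
  so every estimate is an equality.\<close>

lemma low_vertex_state:
  assumes P: "graph_property P" "hereditary P" and crit: "critical_cover P G X H"
    and g: "good_state P G X H v \<tau>" and low: "v \<in> low_vertices P G X"
  shows "\<And>u. u \<in> verts G \<Longrightarrow> u \<noteq> v \<Longrightarrow> (\<Sum>x\<in>X v. mult H x (\<tau> u)) = mult G v u"
    "\<And>x. x \<in> X v \<Longrightarrow> (\<Sum>u\<in>verts G - {v}. mult H x (\<tau> u)) = prop_d P"
proof -
  let ?V = "verts G - {v}"
  have cover: "is_cover G X H" using crit by (simp add: critical_cover_def)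
  have v: "v \<in> verts G" and \<tau>: "\<And>w. w \<in> ?V \<Longrightarrow> \<tau> w \<in> X w"
    and hp: "has_prop P (induced H (\<tau> ` ?V))"
    using g by (auto simp: good_state_def)
  have "X v \<subseteq> verts H" using cover v by (auto simp: is_cover_def)
  hence fin: "finite (X v)" using finite_verts finite_subset by blast
  have finV: "finite ?V" using finite_verts by blast
  have lo: "prop_d P \<le> (\<Sum>u\<in>?V. mult H x (\<tau> u))" if x: "x \<in> X v" for x
  proof (rule row_lower_bound[OF P hp finV subset_refl])
    have img: "(\<tau>(v := x)) ` verts G = insert x (\<tau> ` ?V)" using v by auto
    have "\<forall>w\<in>verts G. (\<tau>(v := x)) w \<in> X w" using \<tau> x by auto
    from transversal_image[OF cover this]
    show "\<not> has_prop P (induced H (insert x (\<tau> ` ?V)))"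
      using crit img unfolding critical_cover_def by metis
  qed
  have hi: "(\<Sum>x\<in>X v. mult H x (\<tau> u)) \<le> mult G v u" if u: "u \<in> ?V" for u
    using cover_col_le[OF cover _ v _ \<tau>[OF u]] u by (auto simp: mult_sym[of G v u])
  have "(\<Sum>x\<in>X v. prop_d P) = (\<Sum>u\<in>?V. mult G v u)"
  proof -
    have "(\<Sum>x\<in>X v. prop_d P) = degree G v" using low by (simp add: low_vertices_def)
    also have "\<dots> = (\<Sum>u\<in>?V. mult G v u)" unfolding degree_eq_sum
      using finite_verts mult_irrefl[of G v] by (intro sum.mono_neutral_right) auto
    finally show ?thesis .
  qed
  moreover have swap: "(\<Sum>x\<in>X v. \<Sum>u\<in>?V. mult H x (\<tau> u)) = (\<Sum>u\<in>?V. \<Sum>x\<in>X v. mult H x (\<tau> u))"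
    by (rule sum.swap)
  moreover have "(\<Sum>x\<in>X v. prop_d P) \<le> (\<Sum>x\<in>X v. \<Sum>u\<in>?V. mult H x (\<tau> u))"
    using lo by (rule sum_mono)
  moreover have "(\<Sum>u\<in>?V. \<Sum>x\<in>X v. mult H x (\<tau> u)) \<le> (\<Sum>u\<in>?V. mult G v u)"
    using hi by (rule sum_mono)
  ultimately have eq1: "(\<Sum>x\<in>X v. prop_d P) = (\<Sum>x\<in>X v. \<Sum>u\<in>?V. mult H x (\<tau> u))"
    and eq2: "(\<Sum>u\<in>?V. \<Sum>x\<in>X v. mult H x (\<tau> u)) = (\<Sum>u\<in>?V. mult G v u)" by linarith+
  show "(\<Sum>u\<in>?V. mult H x (\<tau> u)) = prop_d P" if "x \<in> X v" for x
    using sum_mono_inv[OF eq1 lo that fin] by simp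
  show "(\<Sum>x\<in>X v. mult H x (\<tau> u)) = mult G v u" if "u \<in> verts G" "u \<noteq> v" for u
    using sum_mono_inv[OF eq2 hi _ finV, of u] that by simp
qed

text \<open>If the new placement lost property \<open>P\<close>, then \<open>x\<close> would have at
  least \<open>prop_d P\<close> neighbours among the tokens other than that of \<open>u\<close>, and
  together with the latter its row would exceed \<open>prop_d P\<close>.\<close>

lemma low_vertex_move:
  assumes P: "graph_property P" "hereditary P" and crit: "critical_cover P G X H"
    and g: "good_state P G X H v \<tau>" and low: "v \<in> low_vertices P G X"
    and u: "u \<in> verts G" "u \<noteq> v" and x: "x \<in> X v" "mult H x (\<tau> u) > 0"
  shows "good_state P G X H u (\<tau>(v := x))"
proof -
  let ?V = "verts G - {v}"
  have v: "v \<in> verts G" and \<tau>: "\<And>w. w \<in> ?V \<Longrightarrow> \<tau> w \<in> X w"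
    and hp: "has_prop P (induced H (\<tau> ` ?V))"
    using g by (auto simp: good_state_def)
  have img: "(\<tau>(v := x)) ` (verts G - {u}) = insert x (\<tau> ` (?V - {u}))" using v u by auto
  have "has_prop P (induced H (insert x (\<tau> ` (?V - {u}))))"
  proof (rule ccontr)
    assume "\<not> ?thesis"
    hence "prop_d P \<le> (\<Sum>w\<in>?V - {u}. mult H x (\<tau> w))"
      using finite_verts by (intro row_lower_bound[OF P hp]) auto
    moreover have "(\<Sum>w\<in>?V. mult H x (\<tau> w)) = mult H x (\<tau> u) + (\<Sum>w\<in>?V - {u}. mult H x (\<tau> w))"
      using finite_verts u by (intro sum.remove) auto
    ultimately show False
      using low_vertex_state(2)[OF P crit g low x(1)] x(2) by simp
  qed
  thus ?thesis using u x(1) \<tau> unfolding good_state_def img by auto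
qed

section \<open>Recognising bricks\<close>

lemma brick_complete:
  assumes "t \<ge> 1" "verts B \<noteq> {}" "\<forall>u\<in>verts B. \<forall>w\<in>verts B. u \<noteq> w \<longrightarrow> mult B u w = t"
  shows "brick B"
proof -
  define n where "n = card (verts B)"
  obtain h where h: "bij_betw h (verts B) {0..<n}"
    using ex_bij_betw_finite_nat[OF finite_verts[of B]] by (auto simp: n_def)
  have "n \<ge> 1" using assms(2) finite_verts[of B] by (simp add: n_def Suc_leI card_gt_0_iff)
  have in_n: "h u < n" if "u \<in> verts B" for u using h that by (auto simp: bij_betw_def)
  have inj: "h u = h w \<longleftrightarrow> u = w" if "u \<in> verts B" "w \<in> verts B" for u w
    using h that by (auto simp: bij_betw_def inj_on_def)
  have "iso B (scale t (complete_graph n))"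
    unfolding iso_def verts_scale verts_complete_graph mult_scale mult_complete_graph
    using h in_n inj assms(3) mult_irrefl[of B]
    by (intro exI[of _ h]) (auto simp: atLeast0LessThan)
  thus ?thesis using assms(1) \<open>n \<ge> 1\<close> unfolding brick_def by blast
qed

lemma brick_cycle:
  assumes t: "t \<ge> 1" and c: "distinct c" "set c = verts B" "length c \<ge> 3"
    and m: "\<forall>i<length c. \<forall>j<length c. mult B (c ! i) (c ! j) =
      (if i \<noteq> j \<and> (j = Suc i mod length c \<or> i = Suc j mod length c) then t else 0)"
  shows "brick B"
proof -
  have "iso (scale t (cycle_graph (length c))) B"
    unfolding iso_def verts_scale verts_cycle_graph mult_scale mult_cycle_graph
    using m bij_betw_nth[OF c(1), of "{..<length c}" "verts B"] c(2)
    by (intro exI[of _ "\<lambda>i. c ! i"]) auto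
  thus ?thesis using t c(3) iso_sym unfolding brick_def by blast
qed

lemma nonseparable_reach:
  assumes B: "nonseparable B" and E: "\<And>u w. E u w \<longleftrightarrow> u \<in> verts B \<and> w \<in> verts B \<and> mult B u w > 0"
  shows "\<And>x y. x \<in> verts B \<Longrightarrow> y \<in> verts B \<Longrightarrow> reach E (verts B) x y"
    and "\<And>v x y. v \<in> verts B \<Longrightarrow> x \<in> verts B - {v} \<Longrightarrow> y \<in> verts B - {v} \<Longrightarrow> reach E (verts B - {v}) x y"
proof -
  show "reach E (verts B) x y" if "x \<in> verts B" "y \<in> verts B" for x y
  proof -
    have "(\<lambda>x y. mult B x y > 0) \<le> (\<lambda>x y. E x y \<and> x \<in> verts B \<and> y \<in> verts B)"
      using E mult_in_verts[of B] by auto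
    from rtranclp_mono[OF this] B that show ?thesis
      unfolding reach_def nonseparable_iff connected_graph_def by blast
  qed
  show "reach E (verts B - {v}) x y"
    if "v \<in> verts B" "x \<in> verts B - {v}" "y \<in> verts B - {v}" for v x y
  proof -
    have "connected_graph (delete_vertex B v)" using B that by (auto simp: nonseparable_iff)
    moreover have "verts (delete_vertex B v) = verts B - {v}"
      by (auto simp: delete_vertex_def verts_induced)
    moreover have "(\<lambda>x y. mult (delete_vertex B v) x y > 0) \<le>
        (\<lambda>x y. E x y \<and> x \<in> verts B - {v} \<and> y \<in> verts B - {v})"
      using E by (auto simp: delete_vertex_def mult_induced split: if_splits)
    ultimately show ?thesis using that rtranclp_mono
      unfolding reach_def connected_graph_def by blast
  qed
qed

section \<open>Blocks of the low vertex subgraph\<close>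

theorem theorem4:
  fixes P :: "nat mgraph set" and r :: nat
    and G :: "'a mgraph" and X :: "'a \<Rightarrow> 'b set" and H :: "'b mgraph" and B :: "'a mgraph"
  assumes "reliable P"
    and "prop_d P = r"
    and "critical_cover P G X H"
    and "is_block B (induced G (low_vertices P G X))"
  shows "brick B \<or>
    (\<exists>t B'. t \<ge> 1 \<and> B = scale t B' \<and>
      ((has_prop (CR P) B' \<and> regular r B') \<or> (has_prop P B' \<and> max_degree B' \<le> r)))"
proof -
  have P: "graph_property P" "hereditary P" "nontrivial P"
    using assms(1) by (auto simp: reliable_def)
  have cover: "is_cover G X H" using assms(3) by (simp add: critical_cover_def)
  define W where "W = verts B"
  have nonsep: "nonseparable B" and "verts B \<subseteq> verts (induced G (low_vertices P G X))"
    using assms(4) by (auto simp: is_block_def subgraph_def)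
  hence low: "v \<in> low_vertices P G X" and inV: "v \<in> verts G" if "v \<in> W" for v
    using that by (auto simp: W_def verts_induced)
  \<comment> \<open>A block is induced in the low vertex subgraph, which is itself induced in
    \<open>G\<close>.\<close>
  have mB: "mult B u w = mult G u w" if "u \<in> W" "w \<in> W" for u w
    using arg_cong[OF block_induced[OF assms(4)], of "\<lambda>K. mult K u w"] that low
    by (simp add: mult_induced flip: W_def)
  interpret token_system "verts G" W X "mult H" "mult G" r "good_state P G X H"
  proof
    show "finite (verts G)" by (rule finite_verts)
    show "W \<subseteq> verts G" using inV by blast
    show "finite (X v)" if "v \<in> W" for v
    proof -
      have "X v \<subseteq> verts H" using cover inV[OF that] by (auto simp: is_cover_def)
      thus ?thesis using finite_verts finite_subset by blast
    qed
    show "mult H x y = mult H y x" for x y by (rule mult_sym)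
    show "mult G u v = mult G v u" for u v by (rule mult_sym)
    show "mult G v v = 0" for v by (rule mult_irrefl)
    show "\<tau> u \<in> X u" if "good_state P G X H v \<tau>" "u \<in> verts G" "u \<noteq> v" for v u \<tau>
      using that by (auto simp: good_state_def)
    show "(\<Sum>x\<in>X v. mult H x (\<tau> u)) = mult G v u"
      if "good_state P G X H v \<tau>" "v \<in> W" "u \<in> verts G" "u \<noteq> v" for v u \<tau>
      using low_vertex_state(1)[OF P(1,2) assms(3)] that low by blast
    show "(\<Sum>u\<in>verts G - {v}. mult H x (\<tau> u)) = r"
      if "good_state P G X H v \<tau>" "v \<in> W" "x \<in> X v" for v x \<tau>
      using low_vertex_state(2)[OF P(1,2) assms(3)] that low assms(2) by blast
    show "good_state P G X H u (\<tau>(v := x))"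
      if "good_state P G X H v \<tau>" "v \<in> W" "u \<in> W" "u \<noteq> v" "x \<in> X v" "0 < mult H x (\<tau> u)" for v u x \<tau>
      using low_vertex_move[OF P(1,2) assms(3)] that low inV by blast
  qed
  have E: "E u w \<longleftrightarrow> u \<in> verts B \<and> w \<in> verts B \<and> mult B u w > 0" for u w
    using mB E_def[of u w] by (auto simp: W_def)
  interpret block_token_system "verts G" W X "mult H" "mult G" r "good_state P G X H"
    by unfold_locales (use nonseparable_reach[OF nonsep E] in \<open>auto simp: W_def\<close>)
  have "W \<noteq> {}" using nonsep by (auto simp: W_def nonseparable_def connected_graph_def)
  then obtain v where v: "v \<in> W" by blast
  show ?thesis
  proof (cases "\<exists>v. split_at v")
    case True
    then obtain v0 where sp: "split_at v0" by blast
    obtain t where t: "t \<ge> 1" "\<forall>u w. E u w \<longrightarrow> mult G u w = t"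
      using split_mult_const[OF sp] by blast
    have mt: "mult B u w = (if E u w then t else 0)" if "u \<in> W" "w \<in> W" for u w
      using mB that t(2) by (auto simp: E_def)
    from split_complete_or_cycle[OF sp] have "brick B"
    proof (elim disjE exE conjE)
      assume "\<forall>u\<in>W. \<forall>w\<in>W. u \<noteq> w \<longrightarrow> E u w"
      thus ?thesis using brick_complete[of t B] t(1) mt \<open>W \<noteq> {}\<close> by (auto simp: W_def)
    next
      fix c assume c: "distinct c" "set c = W" "length c \<ge> 3"
        "\<forall>i<length c. \<forall>j<length c. E (c ! i) (c ! j) \<longleftrightarrow>
          i \<noteq> j \<and> (j = Suc i mod length c \<or> i = Suc j mod length c)"
      have "mult B (c ! i) (c ! j) = (if E (c ! i) (c ! j) then t else 0)"
        if "i < length c" "j < length c" for i j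
        using mt c(2) that by (metis nth_mem)
      thus ?thesis using c by (intro brick_cycle[OF t(1), of c]) (auto simp: W_def)
    qed
    thus ?thesis ..
  next
    case ns: False
    show ?thesis
    proof (cases "W = {v}")
      case True
      \<comment> \<open>The multiplicity condition is vacuous for a single vertex, so any
        \<open>t \<ge> 1\<close> would serve.\<close>
      thus ?thesis using brick_complete[of 1 B] by (auto simp: W_def)
    next
      case False
      obtain \<tau> where "good_state P G X H v \<tau>" using ex_good_state[OF assms(3) inV[OF v]] by blast
      then obtain t \<sigma> where t: "t \<ge> 1"
        and \<sigma>: "\<forall>u\<in>W. good_state P G X H u \<sigma> \<and> \<sigma> u \<in> X u"
        and mt: "\<forall>u\<in>W. \<forall>w\<in>W. u \<noteq> w \<longrightarrow> mult G u w = t * mult H (\<sigma> u) (\<sigma> w)"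
        using nonsplit_representation[OF _ v False] ns by blast
      have "finite W" using finite_verts by (simp add: W_def)
      then obtain B' where vB': "verts B' = W"
        and mB': "\<forall>u w. mult B' u w = (if u \<in> W \<and> w \<in> W then mult H (\<sigma> u) (\<sigma> w) else 0)"
        using ex_mgraph[of W "\<lambda>u w. mult H (\<sigma> u) (\<sigma> w)", OF _ mult_sym mult_irrefl] by blast
      have BB': "B = scale t B'"
      proof (rule mgraph_eqI)
        show "verts B = verts (scale t B')" by (simp add: verts_scale vB' W_def)
        fix u w
        show "mult B u w = mult (scale t B') u w"
        proof (cases "u \<in> W \<and> w \<in> W")
          case True
          thus ?thesis using mB mt mB' mult_irrefl[of B u] mult_irrefl[of H "\<sigma> u"]
            by (cases "u = w") (auto simp: mult_scale)
        next
          case False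
          thus ?thesis using mult_in_verts[of B u w] mB' by (auto simp: mult_scale W_def)
        qed
      qed
      let ?K = "induced H (\<sigma> ` W)"
      have \<sigma>H: "\<sigma> ` W \<subseteq> verts H" using \<sigma> cover inV by (auto simp: is_cover_def)
      have inj: "inj_on \<sigma> W"
      proof (rule inj_onI)
        fix u w assume uw: "u \<in> W" "w \<in> W" "\<sigma> u = \<sigma> w"
        hence "X u \<inter> X w \<noteq> {}" using \<sigma> by (metis disjoint_iff)
        thus "u = w" using cover uw inV unfolding is_cover_def disjoint_family_on_def by blast
      qed
      have iso: "iso B' ?K" unfolding iso_def
        using inj \<sigma>H mB' by (intro exI[of _ \<sigma>])
          (auto simp: bij_betw_def vB' verts_induced mult_induced)
      \<comment> \<open>The vertices of \<open>W - {u}\<close> contribute only a part of the row of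
        \<open>\<sigma> u\<close>, whose full sum is \<open>r\<close>.\<close>
      have row_le: "(\<Sum>w\<in>W. mult H (\<sigma> u) (\<sigma> w)) \<le> r" if u: "u \<in> W" for u
      proof -
        have "(\<Sum>w\<in>W. mult H (\<sigma> u) (\<sigma> w)) = (\<Sum>w\<in>W - {u}. mult H (\<sigma> u) (\<sigma> w))"
          using \<open>finite W\<close> mult_irrefl[of H "\<sigma> u"] by (intro sum.mono_neutral_right) auto
        also have "\<dots> \<le> (\<Sum>w\<in>verts G - {u}. mult H (\<sigma> u) (\<sigma> w))"
          using finite_verts inV by (intro sum_mono2) auto
        also have "\<dots> = r" using row \<sigma> u by blast
        finally show ?thesis .
      qed
      have deg: "degree B' u = (\<Sum>w\<in>W. mult H (\<sigma> u) (\<sigma> w))" if "u \<in> W" for u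
        unfolding degree_eq_sum vB' using mB' that by (intro sum.cong) auto
      have "(has_prop (CR P) B' \<and> regular r B') \<or> (has_prop P B' \<and> max_degree B' \<le> r)"
      proof (cases "has_prop P ?K")
        case True
        hence "has_prop P B'" using has_prop_iso iso_sym[OF iso] by blast
        moreover have "max_degree B' \<le> r"
          unfolding max_degree_def vB' using \<open>finite W\<close> \<open>W \<noteq> {}\<close> deg row_le by simp
        ultimately show ?thesis by blast
      next
        case False
        obtain S where S: "S \<subseteq> verts ?K" "\<not> has_prop P (induced ?K S)"
          "has_prop (CR P) (induced ?K S)" "\<forall>y\<in>S. r \<le> (\<Sum>z\<in>S. mult ?K y z)"
          using ex_critical_subgraph[OF P(1,2) False] assms(2) by blast
        have S\<sigma>: "S \<subseteq> \<sigma> ` W" using S(1) by (auto simp: verts_induced)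
        define U where "U = {u \<in> W. \<sigma> u \<in> S}"
        have SU: "S = \<sigma> ` U" using S\<sigma> by (auto simp: U_def)
        have injU: "inj_on \<sigma> U" using inj by (rule inj_on_subset) (auto simp: U_def)
        have ge: "r \<le> (\<Sum>w\<in>U. mult H (\<sigma> u) (\<sigma> w))" if u: "u \<in> U" for u
        proof -
          have "r \<le> (\<Sum>z\<in>S. mult ?K (\<sigma> u) z)" using S(4) u by (simp add: U_def)
          also have "\<dots> = (\<Sum>w\<in>U. mult ?K (\<sigma> u) (\<sigma> w))"
            unfolding SU using sum.reindex[OF injU, of "mult ?K (\<sigma> u)"] by (simp add: comp_def)
          also have "\<dots> \<le> (\<Sum>w\<in>U. mult H (\<sigma> u) (\<sigma> w))"
            by (intro sum_mono) (simp add: mult_induced)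
          finally show ?thesis .
        qed
        \<comment> \<open>An edge leaving \<open>U\<close> would add a positive term to a row that
          already reaches \<open>r\<close>.\<close>
        have closed: "w \<in> U" if "u \<in> U" "E u w" for u w
        proof (rule ccontr)
          assume "w \<notin> U"
          have uw: "u \<in> W" "w \<in> W" "u \<noteq> w" "mult G u w > 0"
            using that E_irrefl by (auto simp: E_def U_def)
          hence pos: "mult H (\<sigma> u) (\<sigma> w) > 0" using mt by auto
          have "(\<Sum>w\<in>insert w U. mult H (\<sigma> u) (\<sigma> w)) \<le> (\<Sum>w\<in>W. mult H (\<sigma> u) (\<sigma> w))"
            using \<open>finite W\<close> uw by (intro sum_mono2) (auto simp: U_def)
          moreover have "finite U" using \<open>finite W\<close> by (simp add: U_def)
          ultimately show False
            using ge[OF that(1)] row_le[OF uw(1)] pos \<open>w \<notin> U\<close> by simp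
        qed
        \<comment> \<open>The empty graph has property \<open>P\<close>, so \<open>S\<close> is not
          empty and the walk through the block has a starting point.\<close>
        have "S \<noteq> {}" using S(2) has_prop_empty[OF P(2,3), of ?K] by auto
        then obtain u0 where u0: "u0 \<in> U" using SU by blast
        have "y \<in> U" if "y \<in> W" for y
        proof -
          have "u0 \<in> W" using u0 by (simp add: U_def)
          from conn[OF this that] show ?thesis unfolding reach_def
            by (induction rule: rtranclp_induct) (use u0 closed in blast)+
        qed
        hence UW: "U = W" by (auto simp: U_def)
        hence "induced ?K S = ?K" by (simp add: SU induced_induced)
        hence "has_prop (CR P) B'" using S(3) has_prop_iso iso_sym[OF iso] by metis
        moreover have "regular r B'"
          unfolding regular_def vB' using deg row_le ge UW by (metis order_antisym)
        ultimately show ?thesis by blast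
      qed
      thus ?thesis using t BB' by blast
    qed
  qed
qed

end
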